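(* Let $N\ge1$ and $1<p<2$. For any $q>2$ there exist two constants $\delta_q\in(0,1)$ and $M_q>0$ such that for every $w\in\mathcal N_q$ with $\|w-1\|_{W^{1,p}(B)}\le\delta_q$ it holds $$I_q(w)-I_q(1)\ge M_q\|w-1\|_{W^{1,p}(B)}^p,$$ where $1$ denotes the constant function equal to $1$.
   Context: $B$ is the open unit ball of $\mathbb R^N$. Norm: $\|u\|_{W^{1,p}(B)}^p=\int_B(|\nabla u|^p+|u|^p)\,dx$. Cone: $\mathcal C:=\{u\in W^{1,p}_{\mathrm{rad}}(B): u\ge 0,\ u(r_1)\le u(r_2)\text{ for all }0<r_1\le r_2\le 1\}$, where $W^{1,p}_{\mathrm{rad}}(B)$ is the subspace of radial functions and $u(|x|):=u(x)$ (radial functions are taken continuous on $(0,1]$, and $u(0):=\lim_{r\to0^+}u(r)$). Truncated nonlinearity: $p^*:=Np/(N-p)$ if $N>p$ and $p^*:=+\infty$ otherwise; $\ell\in(p,p^* )$ is fixed. There is a constant $C(N,p)$, fixed once and for all, with $\|u\|_{L^\infty(B)}\le C(N,p)\|u\|_{W^{1,p}(B)}$ for all $u\in\mathcal C$. Put $p'=p/(p-1)$ and $s_0:=\max\{2+(p')^{1/p},\ C(N,p)(1+|B|^{1/p})\}$. For $q>2$ define $f_q(s)=0$ for $s<0$, $f_q(s)=s^{q-1}$ for $s\in[0,s_0]$, and $f_q(s)=s_0^{q-1}+\frac{q-1}{\ell-1}s_0^{q-\ell}(s^{\ell-1}-s_0^{\ell-1})$ for $s>s_0$. Let $F_q(u)=\int_0^u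 f_q(s)\,ds$. Energy functional on $W^{1,p}(B)$: $I_q(u):=\int_B\left(\frac{|\nabla u|^p}{p}+\frac{|u|^p}{p}-F_q(u)\right)dx$. Nehari-type set: $\mathcal N_q:=\left\{u\in\mathcal C\setminus\{0\}:\int_B(|\nabla u|^p+|u|^p)\,dx=\int_B f_q(u)u\,dx\right\}$. *)

theory Defs
  imports "HOL-Analysis.Analysis" "HOL-Probability.Essential_Supremum"
begin

text \<open>
  Elements of \<open>L\<^sup>p\<close> and \<open>W\<^sup>1\<^sup>,\<^sup>p\<close> are represented by functions on the whole space. Everything below
  depends only on their values almost everywhere in the domain, so that the functions stand for
  their equivalence classes; in particular ``zero'' means zero almost everywhere.
\<close>


section \<open>Sobolev spaces of first order\<close>

primrec C_k :: "nat \<Rightarrow> ('a::euclidean_space \<Rightarrow> real) \<Rightarrow> bool" where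
  "C_k 0 f \<longleftrightarrow> continuous_on UNIV f"
| "C_k (Suc k) f \<longleftrightarrow>
     (\<forall>x. f differentiable (at x)) \<and> (\<forall>i\<in>Basis. C_k k (\<lambda>x. frechet_derivative f (at x) i))"

definition test_functions :: "'a::euclidean_space set \<Rightarrow> ('a \<Rightarrow> real) set" where
  "test_functions \<Omega> = {\<phi>. (\<forall>k. C_k k \<phi>) \<and>
     compact (closure {x. \<phi> x \<noteq> 0}) \<and> closure {x. \<phi> x \<noteq> 0} \<subseteq> \<Omega>}"

definition loc_integrable ::
  "'a::euclidean_space set \<Rightarrow> ('a \<Rightarrow> 'b::{banach, second_countable_topology}) \<Rightarrow> bool" where
  "loc_integrable \<Omega> f \<longleftrightarrow> (\<forall>K. compact K \<and> K \<subseteq> \<Omega> \<longrightarrow> integrable (lebesgue_on K) f)"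

definition has_weak_gradient ::
  "'a::euclidean_space set \<Rightarrow> ('a \<Rightarrow> real) \<Rightarrow> ('a \<Rightarrow> 'a) \<Rightarrow> bool" where
  "has_weak_gradient \<Omega> u g \<longleftrightarrow>
     loc_integrable \<Omega> u \<and> loc_integrable \<Omega> g \<and>
     (\<forall>\<phi>\<in>test_functions \<Omega>. \<forall>i\<in>Basis.
        (\<integral>x. u x * frechet_derivative \<phi> (at x) i \<partial>lebesgue_on \<Omega>)
          = - (\<integral>x. (g x \<bullet> i) * \<phi> x \<partial>lebesgue_on \<Omega>))"

text \<open>The weak gradient is unique up to null sets, so the choice below is immaterial.\<close>

definition weak_gradient ::
  "'a::euclidean_space set \<Rightarrow> ('a \<Rightarrow> real) \<Rightarrow> 'a \<Rightarrow> 'a" where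
  "weak_gradient \<Omega> u = (SOME g. has_weak_gradient \<Omega> u g)"

definition Lp ::
  "'a::euclidean_space set \<Rightarrow> real \<Rightarrow> ('a \<Rightarrow> 'b::{banach, second_countable_topology}) set" where
  "Lp \<Omega> p = {f \<in> borel_measurable (lebesgue_on \<Omega>).
     integrable (lebesgue_on \<Omega>) (\<lambda>x. norm (f x) powr p)}"

definition W1p :: "'a::euclidean_space set \<Rightarrow> real \<Rightarrow> ('a \<Rightarrow> real) set" where
  "W1p \<Omega> p = {u \<in> Lp \<Omega> p. \<exists>g \<in> Lp \<Omega> p. has_weak_gradient \<Omega> u g}"

definition W1p_norm :: "'a::euclidean_space set \<Rightarrow> real \<Rightarrow> ('a \<Rightarrow> real) \<Rightarrow> real" where
  "W1p_norm \<Omega> p u =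
     (\<integral>x. norm (weak_gradient \<Omega> u x) powr p + \<bar>u x\<bar> powr p \<partial>lebesgue_on \<Omega>) powr (1 / p)"


section \<open>The cone of nonnegative, radially nondecreasing functions\<close>

abbreviation unit_ball :: "'a::euclidean_space set" where
  "unit_ball \<equiv> ball 0 1"

definition W1p_rad :: "real \<Rightarrow> ('a::euclidean_space \<Rightarrow> real) set" where
  "W1p_rad p = {u \<in> W1p unit_ball p. \<exists>U::real \<Rightarrow> real. AE x in lebesgue_on unit_ball. u x = U (norm x)}"

text \<open>
  \<open>U\<close> is the radial profile \<open>r \<mapsto> u(r)\<close> of the representative of \<open>u\<close> that is continuous on
  \<open>(0,1]\<close>; it is uniquely determined on that interval.
\<close>

definition radial_profile :: "('a::euclidean_space \<Rightarrow> real) \<Rightarrow> (real \<Rightarrow> real) \<Rightarrow> bool" where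
  "radial_profile u U \<longleftrightarrow>
     continuous_on {0<..1} U \<and> (AE x in lebesgue_on unit_ball. u x = U (norm x))"

definition mono_cone :: "real \<Rightarrow> ('a::euclidean_space \<Rightarrow> real) set" where
  "mono_cone p = {u \<in> W1p_rad p. (AE x in lebesgue_on unit_ball. 0 \<le> u x) \<and>
     (\<exists>U. radial_profile u U \<and> (\<forall>r1 r2. 0 < r1 \<and> r1 \<le> r2 \<and> r2 \<le> 1 \<longrightarrow> U r1 \<le> U r2))}"


section \<open>The truncated nonlinearity, the energy and the Nehari-type set\<close>

definition sobolev_exponent :: "nat \<Rightarrow> real \<Rightarrow> ereal" where
  "sobolev_exponent N p = (if real N > p then ereal (real N * p / (real N - p)) else \<infinity>)"

definition embedding_constant :: "'a::euclidean_space itself \<Rightarrow> real \<Rightarrow> real \<Rightarrow> bool" where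
  "embedding_constant _ p C \<longleftrightarrow>
     (\<forall>u \<in> (mono_cone p :: ('a \<Rightarrow> real) set).
        esssup (lebesgue_on unit_ball) (\<lambda>x. ereal \<bar>u x\<bar>) \<le> ereal (C * W1p_norm unit_ball p u))"

definition trunc_level :: "'a::euclidean_space itself \<Rightarrow> real \<Rightarrow> real \<Rightarrow> real" where
  "trunc_level _ p C = max (2 + (p / (p - 1)) powr (1 / p))
     (C * (1 + measure lebesgue (unit_ball :: 'a set) powr (1 / p)))"

text \<open>In the following definitions \<open>s\<close> is the truncation level and \<open>l\<close> the subcritical exponent.\<close>

definition f_trunc :: "real \<Rightarrow> real \<Rightarrow> real \<Rightarrow> real \<Rightarrow> real" where
  "f_trunc s l q t =
     (if t < 0 then 0
      else if t \<le> s then t powr (q - 1)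
      else s powr (q - 1) + (q - 1) / (l - 1) * s powr (q - l) * (t powr (l - 1) - s powr (l - 1)))"

definition F_trunc :: "real \<Rightarrow> real \<Rightarrow> real \<Rightarrow> real \<Rightarrow> real" where
  "F_trunc s l q t = (LBINT \<tau>=ereal 0..ereal t. f_trunc s l q \<tau>)"

definition energy ::
  "real \<Rightarrow> real \<Rightarrow> real \<Rightarrow> real \<Rightarrow> ('a::euclidean_space \<Rightarrow> real) \<Rightarrow> real" where
  "energy p s l q u =
     (\<integral>x. norm (weak_gradient unit_ball u x) powr p / p + \<bar>u x\<bar> powr p / p - F_trunc s l q (u x)
        \<partial>lebesgue_on unit_ball)"

definition nehari ::
  "real \<Rightarrow> real \<Rightarrow> real \<Rightarrow> real \<Rightarrow> ('a::euclidean_space \<Rightarrow> real) set" where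
  "nehari p s l q = {u \<in> mono_cone p. \<not> (AE x in lebesgue_on unit_ball. u x = 0) \<and>
     (\<integral>x. norm (weak_gradient unit_ball u x) powr p + \<bar>u x\<bar> powr p \<partial>lebesgue_on unit_ball)
       = (\<integral>x. f_trunc s l q (u x) * u x \<partial>lebesgue_on unit_ball)}"

end

theory Submission
  imports Defs
begin

text \<open>
  Let \<open>U\<close> be the radial profile of \<open>w\<close> and \<open>E = \<integral>|\<nabla>w|\<^sup>p\<close>. Testing the weak gradient against the
  fields \<open>\<eta>(|x|\<^sup>2) x\<close>, with \<open>\<eta>\<close> increasing to the indicator function of \<open>[0, r\<^sup>2)\<close>, and using that
  \<open>U\<close> is nondecreasing bounds the mean of \<open>U(r) - w\<close> over the ball of radius \<open>r\<close> by \<open>r\<close> times the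
  mean of \<open>|\<nabla>w|\<close>; no polar coordinates are needed. Summation over dyadic radii gives
  \<open>0 \<le> U(1) - w(x) \<le> A E\<^sup>1\<^sup>/\<^sup>p |x|\<^sup>-\<^sup>\<beta>\<close> for some \<open>\<beta> < N/p\<close>. Hence \<open>z = U(1) - w\<close> satisfies
  \<open>\<integral>z\<^sup>p \<le> C E\<close> and, being bounded, also \<open>\<integral>z\<^sup>2 \<le> C E\<^sup>m\<^sup>/\<^sup>p\<close> for some \<open>m > p\<close>.

  The embedding constant keeps \<open>w\<close> below the truncation level, so that on the Nehari set
  \<open>E = \<integral>(w\<^sup>q - w\<^sup>p) = (q - p) \<integral>(w - 1) + O(\<integral>(w - 1)\<^sup>2)\<close>. For \<open>w\<close> close to \<open>1\<close> this bounds the constant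
  \<open>U(1) - 1\<close> by a multiple of \<open>E\<^sup>1\<^sup>/\<^sup>p\<close>. Therefore \<open>\<parallel>w - 1\<parallel>\<^sup>p \<le> C E\<close> and \<open>\<integral>(w - 1)\<^sup>2 \<le> C E\<^sup>m\<^sup>/\<^sup>p\<close>, and
  expanding the energy to second order at \<open>1\<close> gives \<open>I(w) - I(1) \<ge> E/p - L \<integral>(w - 1)\<^sup>2 \<ge> E/(2p)\<close>
  as soon as \<open>E\<close> is small.
\<close>

section \<open>Explicit test functions\<close>

text \<open>The powers of \<open>1/t\<close> make the family closed under differentiation up to linear combinations.\<close>

definition flat_exp :: "nat \<Rightarrow> real \<Rightarrow> real" where
  "flat_exp n t = (if t \<le> 0 then 0 else exp (- 1 / t) / t ^ n)"

lemma flat_exp_nonneg: "0 \<le> flat_exp n t"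
  by (simp add: flat_exp_def)

lemma flat_exp_0_le_1: "flat_exp 0 t \<le> 1"
  by (simp add: flat_exp_def)

text \<open>A single term of the exponential series of 1/t already bounds exp(1/t) from below, so
  exp(-1/t) vanishes at 0 faster than any power of t. The exponent \<open>k\<close> is free in order
  to beat the division by \<open>t ^ n\<close>.\<close>

lemma flat_exp_le: "flat_exp n t \<le> fact k * t ^ k / t ^ n" if "t > 0"
proof -
  have "(1 / t) ^ k / fact k \<le> exp (1 / t)"
    using sum_le_suminf[OF summable_exp_generic[of "1 / t"], of "{k}"] that
    by (simp add: exp_def divide_inverse mult.commute)
  then have "exp (- 1 / t) \<le> fact k * t ^ k"
    using that by (simp add: exp_minus field_simps)
  then show ?thesis
    using that by (simp add: flat_exp_def divide_right_mono)
qed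

text \<open>For positive \<open>t\<close> this is the quotient rule. For \<open>t \<le> 0\<close>
  the right-hand side is 0, and the difference quotient has to be shown to vanish in the limit,
  which matters only at \<open>t = 0\<close>.\<close>

lemma flat_exp_has_derivative: "(flat_exp n has_real_derivative flat_exp (n + 2) t - n * flat_exp (n + 1) t) (at t)"
proof (cases "t > 0")
  case True
  have "((\<lambda>t. exp (- 1 / t) / t ^ n) has_real_derivative flat_exp (n + 2) t - n * flat_exp (n + 1) t) (at t)"
    using True
    by (auto intro!: derivative_eq_intros simp: flat_exp_def)
      (cases n, auto simp: field_simps power2_eq_square)
  then show ?thesis
    by (rule has_field_derivative_transform_within_open[of _ _ _ "{0<..}"])
      (use True in \<open>auto simp: flat_exp_def\<close>)
next
  case False
  have "((\<lambda>x. (flat_exp n x - flat_exp n t) / (x - t)) \<longlongrightarrow> 0) (at t)"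
  proof (rule Lim_null_comparison)
    \<comment> \<open>Taking \<open>k = n + 2\<close> in \<open>flat_exp_le\<close> leaves x^2 / (x
      - t), and x / (x - t) is at most 1 because \<open>t\<close> is not positive.\<close>
    have "norm ((flat_exp n x - flat_exp n t) / (x - t)) \<le> fact (n + 2) * \<bar>x - t\<bar>" for x
    proof (cases "x > 0")
      case True
      have "flat_exp n x / (x - t) \<le> (fact (n+2) * x ^ (n+2) / x ^ n) / (x - t)"
        using True False by (intro divide_right_mono flat_exp_le) auto
      also have "\<dots> = fact (n+2) * x * (x / (x - t))"
        using True by (simp add: power_add power2_eq_square)
      also have "\<dots> \<le> fact (n+2) * x * 1"
        using True False by (intro mult_left_mono) auto
      also have "\<dots> \<le> fact (n + 2) * (x - t)"
        using False by (simp del: fact_Suc)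
      finally show ?thesis
        using True False flat_exp_nonneg[of n x] by (simp add: flat_exp_def[of n t] del: fact_Suc)
    next
      case nx: False
      with False show ?thesis by (simp add: flat_exp_def)
    qed
    then show "\<forall>\<^sub>F x in at t. norm ((flat_exp n x - flat_exp n t) / (x - t)) \<le> fact (n + 2) * \<bar>x - t\<bar>"
      by simp
    show "((\<lambda>x. fact (n + 2) * \<bar>x - t\<bar>) \<longlongrightarrow> (0::real)) (at t)"
      by (auto intro!: tendsto_eq_intros)
  qed
  with False show ?thesis
    by (simp add: has_field_derivative_iff flat_exp_def)
qed

text \<open>The point of this class is that it is closed under partial derivatives, so that \<open>C_k\<close> follows by induction.\<close>

inductive elem_smooth :: "('a::euclidean_space \<Rightarrow> real) \<Rightarrow> bool" where
  const: "elem_smooth (\<lambda>x. c)"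
| inner: "elem_smooth (\<lambda>x. x \<bullet> v)"
| add: "elem_smooth f \<Longrightarrow> elem_smooth g \<Longrightarrow> elem_smooth (\<lambda>x. f x + g x)"
| mult: "elem_smooth f \<Longrightarrow> elem_smooth g \<Longrightarrow> elem_smooth (\<lambda>x. f x * g x)"
| flat_exp_comp: "elem_smooth f \<Longrightarrow> elem_smooth (\<lambda>x. flat_exp n (f x))"

text \<open>Structural induction. The derivative is kept as a function of point and direction, so
  that each fixed direction again gives a member of the class; for \<open>flat_exp_comp\<close> this
  is where the indices \<open>n + 1\<close> and \<open>n + 2\<close> come in.\<close>

lemma elem_smooth_has_derivative:
  assumes "elem_smooth f"
  shows "\<exists>f'. (\<forall>x. (f has_derivative f' x) (at x)) \<and> (\<forall>i. elem_smooth (\<lambda>x. f' x i))"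
  using assms
proof induction
  case (const c)
  then show ?case
    by (intro exI[of _ "\<lambda>x i. 0"]) (auto intro: elem_smooth.intros)
next
  case (inner v)
  then show ?case
    by (intro exI[of _ "\<lambda>x i. i \<bullet> v"]) (auto intro!: elem_smooth.intros derivative_eq_intros)
next
  case (add f g)
  then obtain f' g' where "\<forall>x. (f has_derivative f' x) (at x)" "\<forall>i. elem_smooth (\<lambda>x. f' x i)"
     "\<forall>x. (g has_derivative g' x) (at x)" "\<forall>i. elem_smooth (\<lambda>x. g' x i)" by blast
  then show ?case
    by (intro exI[of _ "\<lambda>x i. f' x i + g' x i"])
      (auto intro!: elem_smooth.intros has_derivative_add)
next
  case (mult f g)
  then obtain f' g' where "\<forall>x. (f has_derivative f' x) (at x)" "\<forall>i. elem_smooth (\<lambda>x. f' x i)"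
     "\<forall>x. (g has_derivative g' x) (at x)" "\<forall>i. elem_smooth (\<lambda>x. g' x i)" by blast
  with mult.hyps show ?case
    by (intro exI[of _ "\<lambda>x i. f x * g' x i + f' x i * g x"])
      (auto intro!: elem_smooth.intros has_derivative_mult)
next
  case (flat_exp_comp f n)
  then obtain f' where f': "\<forall>x. (f has_derivative f' x) (at x)" "\<forall>i. elem_smooth (\<lambda>x. f' x i)"
    by blast
  show ?case
  proof (intro exI[of _ "\<lambda>x i. f' x i * (flat_exp (n + 2) (f x) + (- real n) * flat_exp (n + 1) (f x))"] conjI allI)
    show "((\<lambda>x. flat_exp n (f x)) has_derivative
        (\<lambda>i. f' x i * (flat_exp (n + 2) (f x) + (- real n) * flat_exp (n + 1) (f x)))) (at x)" for x
      using DERIV_compose_FDERIV[OF flat_exp_has_derivative f'(1)[rule_format, of x], of n] by simp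
    show "elem_smooth (\<lambda>x. f' x i * (flat_exp (n + 2) (f x) + (- real n) * flat_exp (n + 1) (f x)))" for i
      by (intro elem_smooth.intros f'(2)[rule_format] flat_exp_comp.hyps)
  qed
qed

lemma elem_smooth_differentiable: "elem_smooth f \<Longrightarrow> f differentiable (at x)"
  using elem_smooth_has_derivative differentiableI by blast

lemma elem_smooth_continuous: "elem_smooth f \<Longrightarrow> continuous_on A f"
  by (meson continuous_on_eq_continuous_within continuous_on_subset
      differentiable_imp_continuous_within elem_smooth_differentiable subset_UNIV
      continuous_at_imp_continuous_on)

lemma elem_smooth_frechet_derivative: "elem_smooth f \<Longrightarrow> elem_smooth (\<lambda>x. frechet_derivative f (at x) i)"
proof -
  assume "elem_smooth f"
  then obtain f' where f': "\<And>x. (f has_derivative f' x) (at x)" "\<And>i. elem_smooth (\<lambda>x. f' x i)"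
    using elem_smooth_has_derivative by blast
  have "frechet_derivative f (at x) = f' x" for x
    using frechet_derivative_at[OF f'(1)] by simp
  with f'(2) show ?thesis
    by simp
qed

lemma elem_smooth_C_k: "elem_smooth f \<Longrightarrow> C_k k f"
  by (induction k arbitrary: f)
    (auto simp: elem_smooth_continuous elem_smooth_differentiable elem_smooth_frechet_derivative)

lemma elem_smooth_prod:
  "(\<And>i. i \<in> I \<Longrightarrow> elem_smooth (f i)) \<Longrightarrow> elem_smooth (\<lambda>x. \<Prod>i\<in>I. f i x)"
  by (induction I rule: infinite_finite_induct) (auto intro: elem_smooth.intros)

lemma elem_smooth_sum:
  "(\<And>i. i \<in> I \<Longrightarrow> elem_smooth (f i)) \<Longrightarrow> elem_smooth (\<lambda>x. \<Sum>i\<in>I. f i x)"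
  by (induction I rule: infinite_finite_induct) (auto intro: elem_smooth.intros)

lemma elem_smooth_test_function:
  assumes "elem_smooth f" "\<And>x. f x \<noteq> 0 \<Longrightarrow> x \<in> K" "compact K" "K \<subseteq> \<Omega>"
  shows "f \<in> test_functions \<Omega>"
proof -
  have "closure {x. f x \<noteq> 0} \<subseteq> K"
    using assms by (intro closure_minimal compact_imp_closed) auto
  then show ?thesis
    using assms elem_smooth_C_k compact_Int_closed[of K "closure {x. f x \<noteq> 0}"]
    by (auto simp: test_functions_def Int_absorb1)
qed

lemma AE_lebesgue_eq_lborel: "(AE x in lebesgue. P x) \<longleftrightarrow> (AE x in lborel. P x)"
  by (rule AE_completion_iff)

lemma AE_lebesgue_on_iff:
  "S \<in> sets lebesgue \<Longrightarrow> (AE x in lebesgue_on S. P x) \<longleftrightarrow> (AE x in lebesgue. x \<in> S \<longrightarrow> P x)"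
  by (simp add: AE_restrict_space_iff)

section \<open>Uniqueness of weak gradients\<close>

lemma LIMSEQ_zero_unique: "X \<longlonglongrightarrow> L \<Longrightarrow> (\<And>n. X n = 0) \<Longrightarrow> L = (0::real)"
  by (rule LIMSEQ_unique[of X], assumption, rule tendsto_eventually, simp)

text \<open>Open boxes form an intersection-stable generator of the Borel sets, so a Dynkin-class
  argument extends the vanishing to every Borel set. This is carried out for a Borel representative
  \<open>f'\<close>. The whole space, required for complements, is exhausted by growing boxes with
  dominated convergence.\<close>

lemma AE_eq_0_if_integral_box_eq_0:
  fixes f :: "'a::euclidean_space \<Rightarrow> real"
  assumes f: "integrable lebesgue f"
    and box0: "\<And>a b. (\<integral>x. indicator (box a b) x * f x \<partial>lebesgue) = 0"
  shows "AE x in lebesgue. f x = 0"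
proof -
  from f obtain f' where f'[measurable]: "f' \<in> borel_measurable lborel" and ae: "AE x in lborel. f x = f' x"
    using completion_ex_borel_measurable_real[of f lborel] by auto
  have ae': "AE x in lebesgue. f x = f' x"
    using ae by (simp add: AE_lebesgue_eq_lborel)
  have "integrable lebesgue f'"
    using f ae' integrable_cong_AE[of f lebesgue f'] measurable_completion[OF f'] by auto
  then have int: "integrable lborel f'"
    by (simp add: integrable_completion)
  have box: "(\<integral>x. indicator (box a b) x * f' x \<partial>lborel) = 0" for a b
  proof -
    have "(\<integral>x. indicator (box a b) x * f' x \<partial>lborel) = (\<integral>x. indicator (box a b) x * f' x \<partial>lebesgue)"
      by (simp add: integral_completion)
    also have "\<dots> = (\<integral>x. indicator (box a b) x * f x \<partial>lebesgue)"
      using ae' f by (intro integral_cong_AE) (auto simp: measurable_completion intro!: borel_measurable_times)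
    finally show ?thesis
      using box0 by simp
  qed
  have ints: "integrable lborel (\<lambda>x. indicator A x * f' x)" if "A \<in> sets lborel" for A
    using integrable_mult_indicator[OF that int] by simp
  have UNIV0: "(\<integral>x. f' x \<partial>lborel) = 0"
  proof -
    define A where "A n = (box (- (real n *\<^sub>R One)) (real n *\<^sub>R One) :: 'a set)" for n
    have "(\<lambda>n. \<integral>x. indicator (A n) x * f' x \<partial>lborel) \<longlonglongrightarrow> (\<integral>x. f' x \<partial>lborel)"
    proof (rule integral_dominated_convergence[where w = "\<lambda>x. \<bar>f' x\<bar>"])
      show "AE x in lborel. (\<lambda>n. indicat_real (A n) x * f' x) \<longlonglongrightarrow> f' x"
      proof (rule AE_I2)
        fix x :: 'a
        have "x \<in> (\<Union>n. A n)"
          unfolding A_def UN_box_eq_UNIV by simp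
        then obtain m where m: "x \<in> A m" by blast
        have "A m \<subseteq> A n" if "m \<le> n" for n
          using that unfolding A_def by (intro subset_box_imp) auto
        with m have "\<forall>\<^sub>F n in sequentially. x \<in> A n"
          by (intro eventually_sequentiallyI[of m]) blast
        then show "(\<lambda>n. indicat_real (A n) x * f' x) \<longlonglongrightarrow> f' x"
          by (intro tendsto_eventually) (rule eventually_mono, auto simp: indicator_def)
      qed
    qed (use int in \<open>auto simp: indicator_def A_def\<close>)
    then show ?thesis
      by (rule LIMSEQ_zero_unique) (simp add: A_def box)
  qed
  have "set_lebesgue_integral lborel A f' = 0" if "A \<in> sets lborel" for A
  proof -
    have "Int_stable (range (\<lambda>(a, b). box a b::'a set))"
      by (auto simp: Int_stable_def box_Int_box)
    moreover have "range (\<lambda>(a, b). box a b::'a set) \<subseteq> Pow UNIV"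
      by simp
    moreover have "A \<in> sigma_sets UNIV (range (\<lambda>(a, b). box a b::'a set))"
      using that by (simp add: borel_eq_box)
    ultimately have "(\<integral>x. indicator A x * f' x \<partial>lborel) = 0"
    proof (induction rule: sigma_sets_induct_disjoint)
      case (compl A)
      then have A: "A \<in> sets lborel"
        by (simp add: borel_eq_box)
      have "(\<integral>x. indicator (UNIV - A) x * f' x \<partial>lborel) = (\<integral>x. f' x - indicator A x * f' x \<partial>lborel)"
        by (intro Bochner_Integration.integral_cong) (auto simp: indicator_def)
      also have "\<dots> = 0"
        using compl UNIV0 A int ints by (subst Bochner_Integration.integral_diff) auto
      finally show ?case .
    next
      case (union A)
      then have A: "A i \<in> sets lborel" for i
        by (auto simp: borel_eq_box)
      have "set_lebesgue_integral lborel (\<Union>i. A i) f' = (\<Sum>i. set_lebesgue_integral lborel (A i) f')"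
        using union(1) A ints[of "\<Union>i. A i"]
        by (intro lebesgue_integral_countable_add)
          (auto simp: disjoint_family_on_def set_integrable_def)
      with union show ?case
        by (simp add: set_lebesgue_integral_def)
    qed (auto simp: box)
    then show ?thesis
      by (simp add: set_lebesgue_integral_def)
  qed
  then have "AE x in lborel. f' x = 0"
    by (intro sigma_finite_measure.density_zero[OF sigma_finite_lborel] int)
  with ae have "AE x in lborel. f x = 0"
    by eventually_elim simp
  then show ?thesis
    by (simp add: AE_lebesgue_eq_lborel)
qed

section \<open>Local integrability and elementary properties of test functions\<close>

lemma integrable_lebesgue_on_iff:
  fixes f :: "'a::euclidean_space \<Rightarrow> 'b::{banach, second_countable_topology}"
  assumes "S \<in> sets lebesgue"
  shows "integrable (lebesgue_on S) f \<longleftrightarrow> integrable lebesgue (\<lambda>x. indicator S x *\<^sub>R f x)"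
  using assms by (simp add: integrable_restrict_space)

lemma integral_lebesgue_on_eq:
  fixes f :: "'a::euclidean_space \<Rightarrow> 'b::{banach, second_countable_topology}"
  assumes "S \<in> sets lebesgue"
  shows "integral\<^sup>L (lebesgue_on S) f = integral\<^sup>L lebesgue (\<lambda>x. indicator S x *\<^sub>R f x)"
  using assms by (simp add: integral_restrict_space)

text \<open>The continuous factor is bounded on \<open>K\<close> and vanishes elsewhere, so only
  integrability over \<open>K\<close> matters. The values of \<open>u\<close> lie in a Banach space
  so that the lemma serves functions and gradients alike.\<close>

lemma loc_integrable_integrable_mult:
  fixes u :: "'a::euclidean_space \<Rightarrow> 'b::{banach, second_countable_topology}"
  assumes u: "loc_integrable \<Omega> u" and K: "compact K" "K \<subseteq> \<Omega>" and \<Omega>: "\<Omega> \<in> sets lebesgue"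
    and \<phi>: "continuous_on UNIV \<phi>" "\<And>x. x \<notin> K \<Longrightarrow> \<phi> x = 0"
  shows "integrable (lebesgue_on \<Omega>) (\<lambda>x. (\<phi> x :: real) *\<^sub>R u x)"
proof -
  have Kl: "K \<in> sets lebesgue"
    using K(1) by (intro fmeasurableD lmeasurable_compact)
  have "integrable (lebesgue_on K) u"
    using u K by (auto simp: loc_integrable_def)
  then have i: "integrable lebesgue (\<lambda>x. indicator K x *\<^sub>R u x)"
    by (simp add: integrable_lebesgue_on_iff Kl)
  obtain B where B: "\<And>x. x \<in> K \<Longrightarrow> norm (\<phi> x) \<le> B"
    using compact_imp_bounded[OF compact_continuous_image[OF continuous_on_subset[OF \<phi>(1)] K(1)]]
    by (auto simp: bounded_iff)
  have "integrable lebesgue (\<lambda>x. \<phi> x *\<^sub>R (indicator K x *\<^sub>R u x))"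
  proof (rule Bochner_Integration.integrable_bound)
    show "integrable lebesgue (\<lambda>x. B *\<^sub>R norm (indicator K x *\<^sub>R u x))"
      using i by (intro integrable_scaleR_right integrable_norm)
    have "\<phi> \<in> borel_measurable lebesgue"
      using \<phi>(1) by (intro measurable_completion) (auto intro: borel_measurable_continuous_onI)
    then show "(\<lambda>x. \<phi> x *\<^sub>R indicat_real K x *\<^sub>R u x) \<in> borel_measurable lebesgue"
      using borel_measurable_scaleR borel_measurable_integrable[OF i] by blast
    show "AE x in lebesgue. norm (\<phi> x *\<^sub>R indicat_real K x *\<^sub>R u x)
        \<le> norm (B *\<^sub>R norm (indicat_real K x *\<^sub>R u x))"
    proof (rule AE_I2)
      fix x
      show "norm (\<phi> x *\<^sub>R indicat_real K x *\<^sub>R u x) \<le> norm (B *\<^sub>R norm (indicat_real K x *\<^sub>R u x))"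
      proof (cases "x \<in> K")
        case True
        then have "\<bar>\<phi> x\<bar> \<le> \<bar>B\<bar>"
          using B[of x] by simp
        then show ?thesis
          using True by (simp add: abs_mult mult_right_mono)
      qed simp
    qed
  qed
  also have "(\<lambda>x. \<phi> x *\<^sub>R (indicator K x *\<^sub>R u x)) = (\<lambda>x. indicator \<Omega> x *\<^sub>R \<phi> x *\<^sub>R u x)"
    using K(2) \<phi>(2) by (auto simp: fun_eq_iff indicator_def)
  finally show ?thesis
    by (simp add: integrable_lebesgue_on_iff \<Omega>)
qed

lemma test_functionsD:
  assumes "\<phi> \<in> test_functions \<Omega>"
  obtains K where "compact K" "K \<subseteq> \<Omega>" "\<And>x. x \<notin> K \<Longrightarrow> \<phi> x = 0"
      "\<And>x i. x \<notin> K \<Longrightarrow> frechet_derivative \<phi> (at x) i = 0"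
proof -
  define K where "K = closure {x. \<phi> x \<noteq> 0}"
  have K: "compact K" "K \<subseteq> \<Omega>"
    using assms by (auto simp: test_functions_def K_def)
  have 0: "\<phi> x = 0" if "x \<notin> K" for x
    using that closure_subset[of "{x. \<phi> x \<noteq> 0}"] unfolding K_def by blast
  have "frechet_derivative \<phi> (at x) i = 0" if "x \<notin> K" for x i
  proof -
    have "(\<phi> has_derivative (\<lambda>_. 0)) (at x)"
      by (rule has_derivative_transform_within_open[of "\<lambda>_. 0" _ _ _ "- K"])
        (use that 0 K(1) in \<open>auto simp: compact_imp_closed\<close>)
    from fun_cong[OF frechet_derivative_at[OF this], of i] show ?thesis
      by simp
  qed
  with that K 0 show ?thesis
    by blast
qed

lemma test_functions_continuous: "\<phi> \<in> test_functions \<Omega> \<Longrightarrow> continuous_on UNIV \<phi>"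
  unfolding test_functions_def by (metis (no_types, lifting) C_k.simps(1) mem_Collect_eq)

lemma test_functions_has_derivative:
  assumes "\<phi> \<in> test_functions \<Omega>"
  shows "(\<phi> has_derivative frechet_derivative \<phi> (at x)) (at x)"
proof -
  have "C_k (Suc 0) \<phi>"
    using assms unfolding test_functions_def by blast
  then show ?thesis
    by (simp add: frechet_derivative_works[symmetric])
qed

lemma test_functions_continuous_derivative:
  assumes "\<phi> \<in> test_functions \<Omega>" "i \<in> Basis"
  shows "continuous_on UNIV (\<lambda>x. frechet_derivative \<phi> (at x) i)"
proof -
  have "C_k (Suc 0) \<phi>"
    using assms unfolding test_functions_def by blast
  then show ?thesis
    using assms(2) by simp
qed

lemma integrable_compact_support:
  fixes f :: "'a::euclidean_space \<Rightarrow> real"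
  assumes "continuous_on UNIV f" "compact K" "\<And>x. x \<notin> K \<Longrightarrow> f x = 0"
  shows "integrable lborel f"
proof -
  have "set_integrable lborel K f"
    unfolding set_integrable_def using assms(2) continuous_on_subset[OF assms(1)]
    by (intro borel_integrable_compact) auto
  also have "(\<lambda>x. indicator K x *\<^sub>R f x) = f"
    using assms(3) by (auto simp: indicator_def fun_eq_iff)
  then have "set_integrable lborel K f = integrable lborel f"
    by (simp add: set_integrable_def)
  finally show ?thesis .
qed

text \<open>The difference quotients have integral zero by translation invariance.\<close>

lemma integral_partial_derivative_eq_0:
  fixes \<phi> :: "'a::euclidean_space \<Rightarrow> real"
  assumes \<phi>: "\<phi> \<in> test_functions \<Omega>" and i: "i \<in> Basis"
  shows "(\<integral>x. frechet_derivative \<phi> (at x) i \<partial>lborel) = 0"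
proof -
  obtain K where K: "compact K" "\<And>x. x \<notin> K \<Longrightarrow> \<phi> x = 0"
      "\<And>x. x \<notin> K \<Longrightarrow> frechet_derivative \<phi> (at x) i = 0"
    using test_functionsD[OF \<phi>] by metis
  define D where "D x = frechet_derivative \<phi> (at x) i" for x
  have D: "continuous_on UNIV D"
    unfolding D_def by (rule test_functions_continuous_derivative[OF \<phi> i])
  obtain R where R: "\<And>x. x \<in> K \<Longrightarrow> norm x \<le> R"
    using compact_imp_bounded[OF K(1)] by (auto simp: bounded_iff)
  obtain B where B0: "\<And>x. x \<in> K \<Longrightarrow> norm (D x) \<le> B"
    using compact_imp_bounded[OF compact_continuous_image[OF continuous_on_subset[OF D] K(1)]]
    by (auto simp: bounded_iff)
  have B: "\<bar>D x\<bar> \<le> max 0 B" for x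
    using B0[of x] K(3)[of x] by (cases "x \<in> K") (auto simp: D_def)
  have line: "((\<lambda>t. \<phi> (x + t *\<^sub>R i)) has_real_derivative D (x + t *\<^sub>R i)) (at t)" for x t
  proof -
    have "((\<lambda>t. \<phi> (x + t *\<^sub>R i)) has_derivative
        (\<lambda>t'. frechet_derivative \<phi> (at (x + t *\<^sub>R i)) (t' *\<^sub>R i))) (at t)"
      by (rule has_derivative_compose[OF _ test_functions_has_derivative[OF \<phi>]])
        (auto intro!: derivative_eq_intros)
    moreover have "frechet_derivative \<phi> (at y) (t' *\<^sub>R i) = t' * D y" for y t'
      using linear_scale[OF has_derivative_linear[OF test_functions_has_derivative[OF \<phi>, of y]]]
      by (simp add: D_def)
    moreover have "(\<lambda>t'. t' * D y) = (*) (D y)" for y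
      by (simp add: fun_eq_iff)
    ultimately show ?thesis
      by (simp add: has_field_derivative_def)
  qed
  define f where "f n x = real (Suc n) * (\<phi> (x + inverse (real (Suc n)) *\<^sub>R i) - \<phi> x)" for n x
  have meas[measurable]: "\<phi> \<in> borel_measurable borel" "D \<in> borel_measurable borel"
    using test_functions_continuous[OF \<phi>] D by (auto intro: borel_measurable_continuous_onI)
  have int: "integrable lborel \<phi>"
    by (rule integrable_compact_support[OF test_functions_continuous[OF \<phi>] K(1,2)])
  have trans: "integrable lborel (\<lambda>x. \<phi> (x + c))" "(\<integral>x. \<phi> (x + c) \<partial>lborel) = (\<integral>x. \<phi> x \<partial>lborel)" for c
    using integrable_distr_eq[of "(+) c" lborel borel \<phi>] integral_distr[of "(+) c" lborel borel \<phi>] int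
    by (auto simp: lborel_distr_plus add.commute)
  have fint: "(\<integral>x. f n x \<partial>lborel) = 0" for n
    unfolding f_def using int trans by simp
  \<comment> \<open>By the mean value theorem a difference quotient equals \<open>D\<close> at a
    point at distance at most 1 from \<open>x\<close>. It is therefore bounded by the bound of
    \<open>D\<close> and vanishes outside the ball of radius \<open>R + 1\<close>, which gives an
    integrable majorant.\<close>
  have "(\<lambda>n. \<integral>x. f n x \<partial>lborel) \<longlonglongrightarrow> (\<integral>x. D x \<partial>lborel)"
  proof (rule integral_dominated_convergence[where w = "\<lambda>x. max 0 B * indicator (cball 0 (R + 1)) x"])
    show "AE x in lborel. (\<lambda>n. f n x) \<longlonglongrightarrow> D x"
    proof (rule AE_I2)
      fix x
      have "(\<lambda>h. (\<phi> (x + h *\<^sub>R i) - \<phi> x) / h) \<midarrow>0\<rightarrow> D x"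
        using line[of x 0] by (simp add: DERIV_def)
      moreover have "filterlim (\<lambda>n. inverse (real (Suc n))) (at 0) sequentially"
        using LIMSEQ_inverse_real_of_nat by (auto simp: filterlim_at)
      ultimately have "(\<lambda>n. (\<phi> (x + inverse (real (Suc n)) *\<^sub>R i) - \<phi> x) / inverse (real (Suc n))) \<longlonglongrightarrow> D x"
        by (rule filterlim_compose)
      then show "(\<lambda>n. f n x) \<longlonglongrightarrow> D x"
        by (simp add: f_def field_simps)
    qed
    show "AE x in lborel. norm (f n x) \<le> max 0 B * indicator (cball 0 (R + 1)) x" for n
    proof (rule AE_I2)
      fix x
      let ?h = "inverse (real (Suc n))"
      have h: "0 < ?h" "?h \<le> 1"
        by (auto simp: field_simps)
      obtain t where t: "0 < t" "t < ?h" "\<phi> (x + ?h *\<^sub>R i) - \<phi> (x + 0 *\<^sub>R i) = (?h - 0) * D (x + t *\<^sub>R i)"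
        using MVT2[OF h(1), of "\<lambda>t. \<phi> (x + t *\<^sub>R i)" "\<lambda>t. D (x + t *\<^sub>R i)"] line by blast
      then have eq: "f n x = D (x + t *\<^sub>R i)"
        by (simp add: f_def)
      show "norm (f n x) \<le> max 0 B * indicator (cball 0 (R + 1)) x"
      proof (cases "x \<in> cball 0 (R + 1)")
        case True
        then show ?thesis
          using B eq by simp
      next
        case False
        have "norm x \<le> norm (x + t *\<^sub>R i) + norm (t *\<^sub>R i)"
          using norm_triangle_ineq4[of "x + t *\<^sub>R i" "t *\<^sub>R i"] by simp
        also have "norm (t *\<^sub>R i) \<le> 1"
          using t h i by simp
        finally have "x + t *\<^sub>R i \<notin> K"
          using False R[of "x + t *\<^sub>R i"] by auto
        then show ?thesis
          using K(3) False eq by (simp add: D_def)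
      qed
    qed
    show "integrable lborel (\<lambda>x. max 0 B * indicat_real (cball 0 (R + 1)) x)"
      by (intro integrable_mult_right integrable_real_indicator) (use emeasure_lborel_cball_finite[of 0 "R + 1"] in \<open>auto simp: less_top\<close>)
  qed (auto simp: f_def)
  then have "(\<integral>x. D x \<partial>lborel) = 0"
    by (rule LIMSEQ_zero_unique) (rule fint)
  then show ?thesis
    by (simp add: D_def)
qed

lemma integral_partial_derivative_eq_0_on:
  fixes \<phi> :: "'a::euclidean_space \<Rightarrow> real"
  assumes \<phi>: "\<phi> \<in> test_functions \<Omega>" and i: "i \<in> Basis" and \<Omega>: "\<Omega> \<in> sets lebesgue"
  shows "(\<integral>x. frechet_derivative \<phi> (at x) i \<partial>lebesgue_on \<Omega>) = 0"
proof -
  obtain K where K: "K \<subseteq> \<Omega>" "\<And>x. x \<notin> K \<Longrightarrow> frechet_derivative \<phi> (at x) i = 0"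
    using test_functionsD[OF \<phi>] by metis
  then have eq: "(\<lambda>x. indicator \<Omega> x *\<^sub>R frechet_derivative \<phi> (at x) i) = (\<lambda>x. frechet_derivative \<phi> (at x) i)"
    by (auto simp: indicator_def fun_eq_iff)
  then have "(\<integral>x. frechet_derivative \<phi> (at x) i \<partial>lebesgue_on \<Omega>)
      = (\<integral>x. frechet_derivative \<phi> (at x) i \<partial>lebesgue)"
    using integral_lebesgue_on_eq[OF \<Omega>, of "\<lambda>x. frechet_derivative \<phi> (at x) i"] by (simp only: eq)
  also have "\<dots> = 0"
    using integral_partial_derivative_eq_0[OF \<phi> i]
      borel_measurable_continuous_onI[OF test_functions_continuous_derivative[OF \<phi> i]]
    by (subst integral_completion) auto
  finally show ?thesis .
qed

section \<open>Weak gradients and additive constants\<close>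

lemma loc_integrable_const: "loc_integrable \<Omega> (\<lambda>x. c)"
  unfolding loc_integrable_def
proof (intro allI impI)
  fix K assume "compact K \<and> K \<subseteq> \<Omega>"
  then interpret finite_measure "lebesgue_on K"
    by (intro finite_measure_lebesgue_on lmeasurable_compact) auto
  show "integrable (lebesgue_on K) (\<lambda>x. c)"
    by simp
qed

text \<open>The constant contributes \<open>c\<close> times the integral of a partial derivative of
  a test function, which is zero.\<close>

lemma has_weak_gradient_add_const:
  assumes \<Omega>: "\<Omega> \<in> sets lebesgue" and u: "has_weak_gradient \<Omega> u g"
  shows "has_weak_gradient \<Omega> (\<lambda>x. u x + c) g"
proof -
  have lu: "loc_integrable \<Omega> u" "loc_integrable \<Omega> g"
    using u by (auto simp: has_weak_gradient_def)
  have "loc_integrable \<Omega> (\<lambda>x. u x + c)"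
    using lu(1) loc_integrable_const[of \<Omega> c] by (auto simp: loc_integrable_def)
  moreover have "(\<integral>x. (u x + c) * frechet_derivative \<phi> (at x) i \<partial>lebesgue_on \<Omega>)
      = (\<integral>x. u x * frechet_derivative \<phi> (at x) i \<partial>lebesgue_on \<Omega>)"
    if \<phi>: "\<phi> \<in> test_functions \<Omega>" and i: "i \<in> Basis" for \<phi> i
  proof -
    obtain K where K: "compact K" "K \<subseteq> \<Omega>" "\<And>x. x \<notin> K \<Longrightarrow> frechet_derivative \<phi> (at x) i = 0"
      using test_functionsD[OF \<phi>] by metis
    note int = loc_integrable_integrable_mult[OF _ K(1,2) \<Omega> test_functions_continuous_derivative[OF \<phi> i] K(3)]
    have "integrable (lebesgue_on \<Omega>) (\<lambda>x. frechet_derivative \<phi> (at x) i *\<^sub>R u x)"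
      by (rule int[OF lu(1)])
    moreover have "integrable (lebesgue_on \<Omega>) (\<lambda>x. frechet_derivative \<phi> (at x) i *\<^sub>R c)"
      by (rule int[OF loc_integrable_const])
    ultimately show ?thesis
      using integral_partial_derivative_eq_0_on[OF \<phi> i \<Omega>]
      by (simp add: algebra_simps)
  qed
  ultimately show ?thesis
    using u by (auto simp: has_weak_gradient_def)
qed

lemma has_weak_gradient_add_const_iff:
  assumes "\<Omega> \<in> sets lebesgue"
  shows "has_weak_gradient \<Omega> (\<lambda>x. u x + c) g \<longleftrightarrow> has_weak_gradient \<Omega> u g"
  using has_weak_gradient_add_const[OF assms, of u g c]
    has_weak_gradient_add_const[OF assms, of "\<lambda>x. u x + c" g "- c"] by auto

text \<open>
  This is an equality of functions, not just almost everywhere: both sides are the choice made by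
  \<open>SOME\<close> from the same predicate.
\<close>

lemma weak_gradient_add_const:
  "\<Omega> \<in> sets lebesgue \<Longrightarrow> weak_gradient \<Omega> (\<lambda>x. u x + c) = weak_gradient \<Omega> u"
  by (simp add: weak_gradient_def has_weak_gradient_add_const_iff)

section \<open>Smooth approximation of indicators and the fundamental lemma\<close>

lemma flat_exp_0_limit: "(\<lambda>n. flat_exp 0 (real (Suc n) * t)) \<longlonglongrightarrow> (if t > 0 then 1 else 0)"
proof (cases "t > 0")
  case True
  have "(\<lambda>n. exp (- (1 / t) * inverse (real (Suc n)))) \<longlonglongrightarrow> exp (- (1 / t) * 0)"
    by (intro tendsto_intros LIMSEQ_inverse_real_of_nat)
  with True show ?thesis
    by (simp add: flat_exp_def field_simps mult_le_0_iff del: of_nat_Suc)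
next
  case False
  then have "flat_exp 0 (real (Suc n) * t) = 0" for n
    by (simp add: flat_exp_def mult_le_0_iff del: of_nat_Suc)
  with False show ?thesis
    by simp
qed

text \<open>Test functions converging to indicators of boxes give zero integrals over every box
  whose closure lies in the domain. The box criterion then yields \<open>f = 0\<close> on each such
  box, and countably many closed boxes cover the open set.\<close>

lemma fundamental_lemma_calculus_of_variations:
  fixes f :: "'a::euclidean_space \<Rightarrow> real"
  assumes \<Omega>: "open \<Omega>" and f: "loc_integrable \<Omega> f"
    and 0: "\<And>\<phi>. \<phi> \<in> test_functions \<Omega> \<Longrightarrow> (\<integral>x. f x * \<phi> x \<partial>lebesgue_on \<Omega>) = 0"
  shows "AE x in lebesgue_on \<Omega>. f x = 0"
proof -
  have \<Omega>l: "\<Omega> \<in> sets lebesgue"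
    using \<Omega> by auto
  have box0: "(\<integral>x. indicator (box a b) x * f x \<partial>lebesgue) = 0" if ab: "cbox a b \<subseteq> \<Omega>" for a b
  proof -
    \<comment> \<open>Each factor tends to the indicator of a half-space bounding the box. The
      product vanishes outside the open box for every \<open>n\<close>, hence its support stays
      inside \<open>cbox a b\<close>.\<close>
    define \<phi> where "\<phi> n x = (\<Prod>i\<in>Basis. flat_exp 0 (real (Suc n) * (x \<bullet> i - a \<bullet> i)) * flat_exp 0 (real (Suc n) * (b \<bullet> i - x \<bullet> i)))"
      for n and x :: 'a
    have zero: "\<phi> n x = 0" if "x \<notin> box a b" for n x
    proof -
      from that obtain i where "i \<in> Basis" "x \<bullet> i - a \<bullet> i \<le> 0 \<or> b \<bullet> i - x \<bullet> i \<le> 0"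
        by (auto simp: mem_box not_less)
      then show ?thesis
        unfolding \<phi>_def by (intro prod_zero) (auto simp: flat_exp_def mult_le_0_iff simp del: of_nat_Suc)
    qed
    have smooth: "elem_smooth (\<phi> n)" for n
    proof -
      have "elem_smooth (\<lambda>x::'a. \<Prod>i\<in>Basis. flat_exp 0 (real (Suc n) * (x \<bullet> i + (- (a \<bullet> i)))) *
          flat_exp 0 (real (Suc n) * (b \<bullet> i + (- 1) * (x \<bullet> i))))"
        by (intro elem_smooth_prod elem_smooth.intros)
      then show ?thesis
        by (simp add: \<phi>_def[abs_def])
    qed
    have test: "\<phi> n \<in> test_functions \<Omega>" for n
      by (rule elem_smooth_test_function[OF smooth _ compact_cbox ab])
        (use zero box_subset_cbox in blast)
    have bound: "0 \<le> \<phi> n x" "\<phi> n x \<le> 1" for n x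
      unfolding \<phi>_def by (auto intro!: prod_nonneg prod_le_1 mult_nonneg_nonneg mult_le_one flat_exp_nonneg flat_exp_0_le_1)
    have lim: "(\<lambda>n. \<phi> n x) \<longlonglongrightarrow> indicator (box a b) x" for x
    proof (cases "x \<in> box a b")
      case True
      have "(\<lambda>n. \<phi> n x) \<longlonglongrightarrow> (\<Prod>i\<in>Basis. (if x \<bullet> i - a \<bullet> i > 0 then 1 else 0) * (if b \<bullet> i - x \<bullet> i > 0 then 1 else 0))"
        unfolding \<phi>_def by (intro tendsto_intros flat_exp_0_limit)
      also have "(\<Prod>i\<in>Basis. (if x \<bullet> i - a \<bullet> i > 0 then 1 else 0) * (if b \<bullet> i - x \<bullet> i > 0 then 1 else 0)) = indicat_real (box a b) x"
        using True by (auto simp: mem_box intro!: prod.neutral)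
      finally show ?thesis .
    qed (simp add: zero)
    have int: "integrable lebesgue (\<lambda>x. indicator (cbox a b) x * f x)"
      using f ab integrable_lebesgue_on_iff[of "cbox a b" f] by (auto simp: loc_integrable_def)
    have fm: "(\<lambda>x. indicator (cbox a b) x * f x) \<in> borel_measurable lebesgue"
      using int by auto
    have "(\<lambda>n. \<integral>x. indicator (cbox a b) x * f x * \<phi> n x \<partial>lebesgue) \<longlonglongrightarrow> 
        (\<integral>x. indicator (cbox a b) x * f x * indicator (box a b) x \<partial>lebesgue)"
    proof (rule integral_dominated_convergence[where w = "\<lambda>x. \<bar>indicator (cbox a b) x * f x\<bar>"])
      show "AE x in lebesgue. (\<lambda>n. indicat_real (cbox a b) x * f x * \<phi> n x) \<longlonglongrightarrow> indicat_real (cbox a b) x * f x * indicat_real (box a b) x"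
        by (intro AE_I2 tendsto_intros lim)
      show "AE x in lebesgue. norm (indicat_real (cbox a b) x * f x * \<phi> n x) \<le> \<bar>indicat_real (cbox a b) x * f x\<bar>" for n
        using bound by (intro AE_I2) (auto simp: abs_mult mult_left_le indicator_def)
      show "(\<lambda>x. indicat_real (cbox a b) x * f x * \<phi> n x) \<in> borel_measurable lebesgue" for n
        using elem_smooth_continuous[OF smooth[of n], of UNIV]
        by (intro borel_measurable_times fm measurable_completion) (auto intro: borel_measurable_continuous_onI)
      show "(\<lambda>x. indicat_real (cbox a b) x * f x * indicat_real (box a b) x) \<in> borel_measurable lebesgue"
        by (intro borel_measurable_times[OF fm] borel_measurable_indicator fmeasurableD lmeasurable_box)
    qed (use int in auto)
    moreover have "(\<integral>x. indicator (cbox a b) x * f x * \<phi> n x \<partial>lebesgue) = 0" for n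
    proof -
      have "(\<integral>x. indicator (cbox a b) x * f x * \<phi> n x \<partial>lebesgue) = (\<integral>x. indicator \<Omega> x * (f x * \<phi> n x) \<partial>lebesgue)"
        using zero[of _ n] ab box_subset_cbox[of a b]
        by (intro Bochner_Integration.integral_cong) (auto simp: indicator_def)
      then show ?thesis
        using 0[OF test[of n]] \<Omega>l by (simp add: integral_lebesgue_on_eq)
    qed
    ultimately have "(\<integral>x. indicator (cbox a b) x * f x * indicator (box a b) x \<partial>lebesgue) = 0"
      by (rule LIMSEQ_zero_unique)
    also have "(\<lambda>x. indicator (cbox a b) x * f x * indicator (box a b) x) = (\<lambda>x. indicator (box a b) x * f x)"
      using box_subset_cbox[of a b] by (auto simp: indicator_def fun_eq_iff)
    finally show ?thesis .
  qed
  have AE_cbox: "AE x in lebesgue. x \<in> cbox a b \<longrightarrow> f x = 0" if ab: "cbox a b \<subseteq> \<Omega>" for a b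
  proof -
    have int: "integrable lebesgue (\<lambda>x. indicator (cbox a b) x * f x)"
      using f ab integrable_lebesgue_on_iff[of "cbox a b" f] by (auto simp: loc_integrable_def)
    have "integrable lebesgue (\<lambda>x. indicator (box a b) x * (indicator (cbox a b) x * f x))"
      using integrable_mult_indicator[OF _ int, of "box a b"] by simp
    also have "(\<lambda>x. indicator (box a b) x * (indicator (cbox a b) x * f x)) = (\<lambda>x. indicator (box a b) x * f x)"
      using box_subset_cbox[of a b] by (auto simp: indicator_def fun_eq_iff)
    finally have "AE x in lebesgue. indicator (box a b) x * f x = 0"
    proof (rule AE_eq_0_if_integral_box_eq_0)
      fix c d :: 'a
      \<comment> \<open>The box criterion asks for integrals over all boxes. Localising to
        \<open>box a b\<close> turns each one into an integral over an intersection, which is either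
        empty or a box with closure inside the domain.\<close>
      obtain e e' where e: "box c d \<inter> box a b = box e e'"
        by (simp add: box_Int_box)
      have "cbox e e' \<subseteq> \<Omega> \<or> box e e' = {}"
      proof (cases "box e e' = {}")
        case False
        then have ne: "box a b \<noteq> {}"
          using e by blast
        have "box e e' \<subseteq> box a b"
          using e by blast
        from closure_mono[OF this] have "cbox e e' \<subseteq> cbox a b"
          by (simp add: closure_box[OF ne] closure_box[OF False])
        with ab show ?thesis
          by blast
      qed simp
      then have "(\<integral>x. indicator (box e e') x * f x \<partial>lebesgue) = 0"
        using box0[of e e'] by auto
      then show "(\<integral>x. indicator (box c d) x * (indicator (box a b) x * f x) \<partial>lebesgue) = 0"
        by (simp add: e[symmetric] indicator_inter_arith mult.assoc)
    qed
    moreover have "AE x in lebesgue. x \<notin> cbox a b - box a b"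
      using negligible_frontier_interval[of a b] by (intro AE_not_in) (simp add: negligible_iff_null_sets)
    ultimately show ?thesis
      by eventually_elim auto
  qed
  obtain \<D> where D: "countable \<D>" "\<D> \<subseteq> Pow \<Omega>" "\<And>X. X \<in> \<D> \<Longrightarrow> \<exists>a b. X = cbox a b" "\<Union>\<D> = \<Omega>"
    using open_countable_Union_open_cbox[OF \<Omega>] by metis
  have "AE x in lebesgue. \<forall>X\<in>\<D>. x \<in> X \<longrightarrow> f x = 0"
    using D AE_cbox by (subst AE_ball_countable) (auto, metis PowD subset_eq)
  then have "AE x in lebesgue. x \<in> \<Omega> \<longrightarrow> f x = 0"
    using D(4) by (auto elim!: eventually_mono)
  then show ?thesis
    by (simp add: AE_lebesgue_on_iff \<Omega>l)
qed

text \<open>Subtracting the two defining identities makes every component of the difference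
  orthogonal to all test functions, so the fundamental lemma applies componentwise. This is what
  allows any gradient to be exchanged for the one chosen by \<open>weak_gradient\<close>.\<close>

lemma weak_gradient_unique:
  fixes u :: "'a::euclidean_space \<Rightarrow> real"
  assumes \<Omega>: "open \<Omega>" and g: "has_weak_gradient \<Omega> u g" "has_weak_gradient \<Omega> u g'"
  shows "AE x in lebesgue_on \<Omega>. g x = g' x"
proof -
  have \<Omega>l: "\<Omega> \<in> sets lebesgue"
    using \<Omega> by auto
  have l: "loc_integrable \<Omega> (\<lambda>x. g x \<bullet> i)" "loc_integrable \<Omega> (\<lambda>x. g' x \<bullet> i)" for i
    using g by (auto simp: has_weak_gradient_def loc_integrable_def)
  have "AE x in lebesgue_on \<Omega>. g x \<bullet> i - g' x \<bullet> i = 0" if i: "i \<in> Basis" for i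
  proof (rule fundamental_lemma_calculus_of_variations[OF \<Omega>])
    show "loc_integrable \<Omega> (\<lambda>x. g x \<bullet> i - g' x \<bullet> i)"
      using l by (auto simp: loc_integrable_def)
    fix \<phi> assume \<phi>: "\<phi> \<in> test_functions \<Omega>"
    obtain K where K: "compact K" "K \<subseteq> \<Omega>" "\<And>x. x \<notin> K \<Longrightarrow> \<phi> x = 0"
      using test_functionsD[OF \<phi>] by metis
    have "integrable (lebesgue_on \<Omega>) (\<lambda>x. \<phi> x *\<^sub>R (g x \<bullet> i))"
         "integrable (lebesgue_on \<Omega>) (\<lambda>x. \<phi> x *\<^sub>R (g' x \<bullet> i))"
      using loc_integrable_integrable_mult[OF _ K(1,2) \<Omega>l test_functions_continuous[OF \<phi>] K(3)] l
      by blast+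
    moreover have "(\<integral>x. (g x \<bullet> i) * \<phi> x \<partial>lebesgue_on \<Omega>) = (\<integral>x. (g' x \<bullet> i) * \<phi> x \<partial>lebesgue_on \<Omega>)"
      using g \<phi> i by (auto simp: has_weak_gradient_def)
    ultimately show "(\<integral>x. (g x \<bullet> i - g' x \<bullet> i) * \<phi> x \<partial>lebesgue_on \<Omega>) = 0"
      by (simp add: algebra_simps)
  qed
  then have "AE x in lebesgue_on \<Omega>. \<forall>i\<in>Basis. g x \<bullet> i - g' x \<bullet> i = 0"
    by (subst AE_ball_countable) (auto simp: countable_finite)
  then show ?thesis
    by eventually_elim (auto intro: euclidean_eqI)
qed

section \<open>Decay of monotone radial functions\<close>

lemma flat_exp_le_inverse_power: "0 < y \<Longrightarrow> flat_exp n y \<le> 1 / y ^ n"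
  by (simp add: flat_exp_def divide_right_mono)

lemma elem_smooth_inner_self: "elem_smooth (\<lambda>x::'a::euclidean_space. x \<bullet> x)"
proof -
  have "elem_smooth (\<lambda>x::'a. \<Sum>i\<in>Basis. (x \<bullet> i) * (x \<bullet> i))"
    by (intro elem_smooth_sum elem_smooth.intros)
  then show ?thesis
    by (subst euclidean_inner) simp
qed

text \<open>These are the diagonal entries of the Jacobian of a radial cutoff times the identity
  field; their sum over the basis is its divergence. Only \<open>flat_exp 2\<close> appears since
  the other term of \<open>flat_exp_has_derivative\<close> carries the factor
  \<open>n = 0\<close>.\<close>

lemma frechet_derivative_radial_field:
  fixes x i :: "'a::euclidean_space"
  assumes i: "i \<in> Basis"
  shows "frechet_derivative (\<lambda>x. flat_exp 0 (m * (r - x \<bullet> x)) * (x \<bullet> i)) (at x) i =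
    flat_exp 0 (m * (r - x \<bullet> x)) - 2 * m * (x \<bullet> i)\<^sup>2 * flat_exp 2 (m * (r - x \<bullet> x))"
proof -
  have 1: "((\<lambda>x. m * (r - x \<bullet> x)) has_derivative (\<lambda>y. - 2 * m * (x \<bullet> y))) (at x)"
    by (auto intro!: derivative_eq_intros simp: inner_commute algebra_simps)
  have "((\<lambda>x. flat_exp 0 (m * (r - x \<bullet> x))) has_derivative (\<lambda>y. - 2 * m * (x \<bullet> y) * flat_exp 2 (m * (r - x \<bullet> x)))) (at x)"
    using DERIV_compose_FDERIV[OF flat_exp_has_derivative 1, of 0] by (simp add: numeral_2_eq_2)
  from has_derivative_mult[OF this has_derivative_inner_left[OF has_derivative_ident, of i]]
  have "((\<lambda>x. flat_exp 0 (m * (r - x \<bullet> x)) * (x \<bullet> i)) has_derivative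
      (\<lambda>y. flat_exp 0 (m * (r - x \<bullet> x)) * (y \<bullet> i) + - 2 * m * (x \<bullet> y) * flat_exp 2 (m * (r - x \<bullet> x)) * (x \<bullet> i))) (at x)"
    by simp
  from frechet_derivative_at[OF this, symmetric] show ?thesis
    using i by (simp add: power2_eq_square)
qed

text \<open>With a suitable \<open>t\<close> this replaces Hoelder's inequality.\<close>

lemma le_add_powr:
  fixes a t p :: real
  assumes "0 \<le> a" "0 < t" "1 \<le> p"
  shows "a \<le> t + a powr p * t powr (1 - p)"
proof (cases "a \<le> t")
  case True
  then show ?thesis
    by (simp add: add_increasing2)
next
  case False
  then have "a = a powr p * a powr (1 - p)"
    using assms by (simp flip: powr_add)
  also have "\<dots> \<le> a powr p * t powr (1 - p)"
    using False assms by (intro mult_left_mono powr_mono2') auto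
  finally show ?thesis
    using assms by simp
qed

section \<open>Measures of balls and integrability of powers of the norm\<close>

lemma integral_indicator_ball:
  assumes r: "0 \<le> r" "r \<le> 1"
  shows "(\<integral>x. indicator (ball (0::'a::euclidean_space) r) x \<partial>lebesgue_on unit_ball)
    = measure lebesgue (unit_ball :: 'a set) * r ^ DIM('a)"
proof -
  have "(\<integral>x. indicator (ball (0::'a) r) x \<partial>lebesgue_on unit_ball) = (\<integral>x. indicat_real (ball (0::'a) r) x \<partial>lebesgue)"
    unfolding integral_lebesgue_on_eq[OF fmeasurableD[OF lmeasurable_ball]]
    using r by (intro Bochner_Integration.integral_cong) (auto simp: indicator_def)
  also have "\<dots> = measure lebesgue (ball (0::'a) r)"
    by simp
  also have "\<dots> = r ^ DIM('a) * measure lebesgue (unit_ball :: 'a set)"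
    using content_ball_conv_unit_ball[OF r(1), of "0::'a"] by simp
  finally show ?thesis
    by (simp add: mult.commute)
qed

lemma emeasure_lebesgue_on_ball:
  assumes r: "0 \<le> r" "r \<le> 1"
  shows "emeasure (lebesgue_on unit_ball) (ball (0::'a::euclidean_space) r)
    = ennreal (measure lebesgue (unit_ball :: 'a set) * r ^ DIM('a))"
proof -
  have "emeasure (lebesgue_on unit_ball) (ball (0::'a) r) = emeasure lebesgue (ball (0::'a) r)"
    using r by (intro emeasure_restrict_space) (auto simp: subset_ball)
  also have "\<dots> = ennreal (r ^ DIM('a) * measure lebesgue (unit_ball :: 'a set))"
    using content_ball_conv_unit_ball[OF r(1), of "0::'a"] emeasure_lborel_ball_finite[of "0::'a" r]
    by (simp add: emeasure_eq_ennreal_measure)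
  finally show ?thesis
    by (simp add: mult.commute)
qed

lemma AE_norm_pos: "AE x::'a::euclidean_space in lebesgue_on unit_ball. 0 < norm x"
proof -
  have "AE x::'a in lebesgue. x \<noteq> 0"
    using AE_lborel_singleton[of "0::'a"] by (simp add: AE_lebesgue_eq_lborel)
  then show ?thesis
    by (auto simp: AE_lebesgue_on_iff elim!: eventually_mono)
qed

text \<open>The function is dominated by a weighted sum of indicators of dyadic balls. As the ball
  of radius 2^(-k) has measure proportional to 2^(-kN), with N the dimension, the integrals form a
  geometric series of ratio 2^(\<open>\<gamma>\<close> - N), which is below 1.\<close>

lemma integrable_norm_powr:
  assumes g: "0 \<le> \<gamma>" "\<gamma> < real DIM('a::euclidean_space)"
  shows "integrable (lebesgue_on unit_ball) (\<lambda>x::'a. norm x powr - \<gamma>)"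
proof (rule integrableI_bounded)
  let ?M = "lebesgue_on (unit_ball :: 'a set)" and ?\<omega> = "measure lebesgue (unit_ball :: 'a set)"
  \<comment> \<open>This bounds the function on the shell where the norm lies between 2^(-k-1) and
    2^(-k).\<close>
  define c where "c k = 2 powr (\<gamma> * (real k + 1))" for k
  have "(\<lambda>x::'a. norm x powr - \<gamma>) \<in> borel_measurable lebesgue"
    by (rule measurable_completion) measurable
  then show "(\<lambda>x::'a. norm x powr - \<gamma>) \<in> borel_measurable ?M"
    by (rule measurable_restrict_space1)
  have ball_sets: "ball (0::'a) ((1/2) ^ k) \<in> sets ?M" for k
    by (auto simp: sets_restrict_space_iff power_le_one subset_ball)
  have "(\<integral>\<^sup>+ x. ennreal (norm (norm x powr - \<gamma>)) \<partial>?M)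
      \<le> (\<integral>\<^sup>+ x. (\<Sum>k. ennreal (c k) * indicator (ball 0 ((1/2) ^ k)) x) \<partial>?M)"
  proof (rule nn_integral_mono_AE)
    show "AE x in ?M. ennreal (norm (norm x powr - \<gamma>)) \<le> (\<Sum>k. ennreal (c k) * indicator (ball 0 ((1/2) ^ k)) x)"
      using AE_norm_pos AE_space
    proof eventually_elim
      case (elim x)
      define k where "k = (LEAST n. (1/2) ^ n \<le> norm x)"
      have "\<exists>n. (1/2) ^ n < norm x"
        using elim(1) by (intro real_arch_pow_inv) auto
      then have k: "(1/2) ^ k \<le> norm x"
        unfolding k_def by (metis (mono_tags, lifting) LeastI less_imp_le)
      have "k \<noteq> 0"
        using k elim(2) by (intro notI) auto
      then obtain j where j: "k = Suc j"
        using not0_implies_Suc by blast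
      have xj: "norm x < (1/2) ^ j"
        using not_less_Least[of j "\<lambda>n. (1/2) ^ n \<le> norm x"] j by (simp add: k_def)
      have "norm x powr - \<gamma> \<le> ((1/2) ^ k) powr - \<gamma>"
        using k g by (intro powr_mono2') auto
      also have "((1/2::real) ^ k) = 2 powr - real k"
        by (simp add: powr_minus_divide powr_realpow power_one_over)
      also have "(2 powr - real k) powr - \<gamma> = c j"
        by (simp add: powr_powr c_def j algebra_simps)
      finally have "ennreal (norm (norm x powr - \<gamma>)) \<le> ennreal (c j) * indicator (ball 0 ((1/2) ^ j)) x"
        using xj by (simp add: ennreal_leI)
      also have "\<dots> = (\<Sum>k\<in>{j}. ennreal (c k) * indicator (ball 0 ((1/2) ^ k)) x)"
        by (simp only: sum.insert[OF finite.emptyI] empty_iff not_False_eq_True sum.empty add_0_right)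
      also have "\<dots> \<le> (\<Sum>k. ennreal (c k) * indicator (ball 0 ((1/2) ^ k)) x)"
        by (rule sum_le_suminf) auto
      finally show ?case .
    qed
  qed
  also have "\<dots> = (\<Sum>k. ennreal (c k) * emeasure ?M (ball 0 ((1/2) ^ k)))"
    using ball_sets by (simp add: nn_integral_suminf nn_integral_cmult_indicator)
  also have "\<dots> = (\<Sum>k. ennreal (?\<omega> * 2 powr \<gamma> * (2 powr (\<gamma> - real DIM('a))) ^ k))"
  proof (rule suminf_cong)
    fix k
    have "c k * (?\<omega> * ((1/2) ^ k) ^ DIM('a)) = ?\<omega> * 2 powr \<gamma> * (2 powr (\<gamma> - real DIM('a))) ^ k"
    proof -
      have "((1/2::real) ^ k) ^ DIM('a) = 2 powr (- real DIM('a) * real k)"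
        by (simp add: powr_minus_divide powr_realpow power_one_over mult.commute flip: power_mult of_nat_mult)
      moreover have "(2 powr (\<gamma> - real DIM('a))) ^ k = 2 powr (\<gamma> * real k + - real DIM('a) * real k)"
        by (simp add: powr_powr algebra_simps flip: powr_realpow)
      ultimately show ?thesis
        by (simp add: c_def powr_add powr_diff powr_minus_divide algebra_simps)
    qed
    then show "ennreal (c k) * emeasure ?M (ball 0 ((1/2) ^ k))
      = ennreal (?\<omega> * 2 powr \<gamma> * (2 powr (\<gamma> - real DIM('a))) ^ k)"
      by (subst emeasure_lebesgue_on_ball) (auto simp: power_le_one c_def simp flip: ennreal_mult)
  qed
  also have "\<dots> < \<infinity>"
  proof -
    have "2 powr (\<gamma> - real DIM('a)) < 2 powr 0"
      using g by (intro powr_less_mono) auto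
    then have "summable (\<lambda>k. ?\<omega> * 2 powr \<gamma> * (2 powr (\<gamma> - real DIM('a))) ^ k)"
      by (intro summable_mult summable_geometric) auto
    then show ?thesis
      by (subst suminf_ennreal2) auto
  qed
  finally show "(\<integral>\<^sup>+ x. ennreal (norm (norm x powr - \<gamma>)) \<partial>?M) < \<infinity>" .
qed

section \<open>Constants and setting of the decay estimate\<close>

definition halving_const :: "real \<Rightarrow> real \<Rightarrow> real" where
  "halving_const N \<omega> = 2 powr N * (\<omega> + 1) / (N * \<omega>)"

text \<open>The second factor is the sum of the geometric series with ratio
  2^(-\<open>\<beta>\<close>), which collects the dyadic increments. Neither constant depends on the
  function considered, and this makes the final constants uniform.\<close>

definition decay_const :: "real \<Rightarrow> real \<Rightarrow> real \<Rightarrow> real" where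
  "decay_const N \<omega> \<beta> = halving_const N \<omega> * (1 + 1 / (2 powr \<beta> - 1))"

text \<open>Here \<open>g\<close> may be any weak gradient in the Lebesgue space. \<open>N\<close>
  and \<open>\<omega>\<close> are real parameters tied to the dimension and the volume of the ball
  so that exponents and constants can be written without type coercions.\<close>

locale radial_monotone =
  fixes u :: "'a::euclidean_space \<Rightarrow> real" and g :: "'a \<Rightarrow> 'a" and U :: "real \<Rightarrow> real" and p N \<omega> :: real
  assumes p: "1 < p"
    and N_eq: "N = real DIM('a)"
    and \<omega>_eq: "\<omega> = measure lebesgue (unit_ball :: 'a set)"
    and grad: "has_weak_gradient unit_ball u g"
    and g_Lp: "g \<in> Lp unit_ball p"
    and u_int: "integrable (lebesgue_on unit_ball) u"
    and u_nonneg: "AE x in lebesgue_on unit_ball. 0 \<le> u x"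
    and U_cont: "continuous_on {0<..1} U"
    and u_eq: "AE x in lebesgue_on unit_ball. u x = U (norm x)"
    and U_mono: "\<And>r s. 0 < r \<Longrightarrow> r \<le> s \<Longrightarrow> s \<le> 1 \<Longrightarrow> U r \<le> U s"
begin

abbreviation "B \<equiv> (unit_ball :: 'a set)"
abbreviation "M \<equiv> lebesgue_on B"
abbreviation "Ep \<equiv> (\<integral>x. norm (g x) powr p \<partial>M)"

sublocale finite_measure M
  by (intro finite_measure_lebesgue_on) simp

lemma B_sets[measurable, simp]: "B \<in> sets lebesgue"
  by simp

lemma g_measurable[measurable]: "g \<in> borel_measurable M"
  and g_p_int: "integrable M (\<lambda>x. norm (g x) powr p)"
  using g_Lp by (auto simp: Lp_def)

lemma g_int: "integrable M g"
proof (rule Bochner_Integration.integrable_bound)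
  show "integrable M (\<lambda>x. 1 + norm (g x) powr p * 1 powr (1 - p))"
    using g_p_int by simp
  show "AE x in M. norm (g x) \<le> norm (1 + norm (g x) powr p * 1 powr (1 - p))"
    using le_add_powr[of _ 1 p] p by (intro AE_I2) (auto simp: abs_of_nonneg)
qed simp

lemma ball_indicator_measurable[measurable]: "indicat_real (ball (0::'a) r) \<in> borel_measurable M"
  by (intro measurable_restrict_space1 borel_measurable_indicator lmeasurable_ball fmeasurableD)

lemma ball_indicator_int: "integrable M (indicat_real (ball (0::'a) r))"
  by (rule integrable_const_bound[of _ 1]) (auto simp: indicator_def)

lemma measure_ball: "0 \<le> r \<Longrightarrow> r \<le> 1 \<Longrightarrow> measure M (ball (0::'a) r \<inter> B) = \<omega> * r powr N"
  using integral_indicator_ball[of r, where 'a = 'a] by (auto simp: powr_realpow' \<omega>_eq N_eq)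

lemma integrable_mult_ball:
  assumes f: "integrable M f"
  shows "integrable M (\<lambda>x. f x * indicat_real (ball 0 r) x)"
proof (rule Bochner_Integration.integrable_bound[OF f])
  show "(\<lambda>x. f x * indicat_real (ball 0 r) x) \<in> borel_measurable M"
    by (intro borel_measurable_times borel_measurable_integrable[OF f] ball_indicator_measurable)
qed (auto simp: indicator_def)

lemma \<omega>_pos: "\<omega> > 0"
  using content_ball_pos[of 1 "0::'a"] by (simp add: \<omega>_eq)

text \<open>The field x \<open>\<sigma>\<close>(x) has divergence \<open>N * \<sigma> - k\<close>.
  Testing the weak gradient against its components and summing gives the identity for
  \<open>u\<close>; the last identity is its analogue for the constant function 1. For large
  \<open>m\<close> the nonnegative weight \<open>k\<close> concentrates near the sphere of radius
  \<open>r\<close> and plays the role of a surface measure.\<close>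

lemma divergence_identity:
  fixes r m :: real
  assumes r: "0 < r" "r < 1" and m: "0 < m"
  defines "\<sigma> \<equiv> \<lambda>x::'a. flat_exp 0 (m * (r\<^sup>2 - x \<bullet> x))" and "k \<equiv> \<lambda>x::'a. 2 * m * (x \<bullet> x) * flat_exp 2 (m * (r\<^sup>2 - x \<bullet> x))"
  shows "integrable M (\<lambda>x. u x * k x)" "integrable M (\<lambda>x. u x * \<sigma> x)" "integrable M (\<lambda>x. g x \<bullet> x * \<sigma> x)"
    "integrable M k" "integrable M \<sigma>"
    "(\<integral>x. u x * k x \<partial>M) = N * (\<integral>x. u x * \<sigma> x \<partial>M) + (\<integral>x. g x \<bullet> x * \<sigma> x \<partial>M)"
    "(\<integral>x. k x \<partial>M) = N * (\<integral>x. \<sigma> x \<partial>M)"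
proof -
  have sm: "elem_smooth (\<lambda>x::'a. m * (r\<^sup>2 + (- 1) * (x \<bullet> x)))"
    by (intro elem_smooth.intros elem_smooth_inner_self)
  then have sm: "elem_smooth (\<lambda>x::'a. m * (r\<^sup>2 - x \<bullet> x))"
    by simp
  have \<sigma>_smooth: "elem_smooth \<sigma>" and k_smooth: "elem_smooth k"
    unfolding \<sigma>_def k_def by (intro elem_smooth.intros elem_smooth_inner_self sm)+
  \<comment> \<open>Outside the closed ball of radius \<open>r\<close> the argument of
    \<open>flat_exp\<close> is not positive, so the cutoff and all quantities derived from it vanish
    there.\<close>
  have out: "m * (r\<^sup>2 - x \<bullet> x) \<le> 0" if "x \<notin> cball 0 r" for x :: 'a
    using that r m by (auto simp: mult_le_0_iff dot_square_norm power_mono)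
  have \<sigma>0: "\<sigma> x = 0" and k0: "k x = 0" if "x \<notin> cball 0 r" for x
    using out[OF that] by (auto simp: \<sigma>_def k_def flat_exp_def)
  define \<phi> where "\<phi> i x = \<sigma> x * (x \<bullet> i)" for i x :: 'a
  have \<phi>_smooth: "elem_smooth (\<phi> i)" for i
    unfolding \<phi>_def[abs_def] by (intro elem_smooth.intros \<sigma>_smooth)
  have sub: "cball 0 r \<subseteq> B"
    using r by auto
  have \<phi>0: "\<phi> i x = 0" if "x \<notin> cball 0 r" for i x
    using \<sigma>0[OF that] by (simp add: \<phi>_def)
  have test: "\<phi> i \<in> test_functions B" for i
    by (rule elem_smooth_test_function[OF \<phi>_smooth _ compact_cball sub]) (use \<phi>0 in blast)
  define d where "d i x = \<sigma> x - 2 * m * (x \<bullet> i)\<^sup>2 * flat_exp 2 (m * (r\<^sup>2 - x \<bullet> x))" for i x :: 'a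
  have fd: "frechet_derivative (\<phi> i) (at x) i = d i x" if "i \<in> Basis" for i x
    using frechet_derivative_radial_field[OF that, of m "r\<^sup>2" x] by (simp add: \<phi>_def[abs_def] \<sigma>_def d_def)
  have d_smooth: "elem_smooth (d i)" if "i \<in> Basis" for i
    using elem_smooth_frechet_derivative[OF \<phi>_smooth, of i i] by (simp add: fd[OF that])
  have d0: "d i x = 0" if "x \<notin> cball 0 r" for i x
    using out[OF that] \<sigma>0[OF that] by (simp add: d_def flat_exp_def)
  have sum_d: "(\<Sum>i\<in>Basis. d i x) = N * \<sigma> x - k x" for x
  proof -
    have "(\<Sum>i\<in>Basis. d i x) = N * \<sigma> x - (\<Sum>i\<in>Basis. 2 * m * (x \<bullet> i)\<^sup>2 * flat_exp 2 (m * (r\<^sup>2 - x \<bullet> x)))"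
      by (simp add: d_def sum_subtractf N_eq)
    also have "(\<Sum>i\<in>Basis. 2 * m * (x \<bullet> i)\<^sup>2 * flat_exp 2 (m * (r\<^sup>2 - x \<bullet> x))) = k x"
      by (simp add: k_def euclidean_inner[of x x] power2_eq_square sum_distrib_left sum_distrib_right)
    finally show ?thesis .
  qed
  have locu: "loc_integrable B u" and locg: "loc_integrable B g"
    using grad by (auto simp: has_weak_gradient_def)
  have int: "integrable M (\<lambda>x. f x *\<^sub>R v x)"
    if "elem_smooth f" "\<And>x. x \<notin> cball 0 r \<Longrightarrow> f x = 0" "loc_integrable B v"
    for f and v :: "'a \<Rightarrow> 'b::{banach, second_countable_topology}"
    by (rule loc_integrable_integrable_mult[OF that(3) compact_cball sub B_sets elem_smooth_continuous[OF that(1)]])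
      (rule that(2))
  show uk: "integrable M (\<lambda>x. u x * k x)"
    using int[OF k_smooth k0 locu] by (simp add: mult.commute)
  show us: "integrable M (\<lambda>x. u x * \<sigma> x)"
    using int[OF \<sigma>_smooth \<sigma>0 locu] by (simp add: mult.commute)
  have g\<phi>: "integrable M (\<lambda>x. (g x \<bullet> i) * \<phi> i x)" for i
  proof -
    have "integrable M (\<lambda>x. (\<phi> i x *\<^sub>R g x) \<bullet> i)"
      by (intro integrable_inner_left int[OF \<phi>_smooth \<phi>0 locg])
    then show ?thesis
      by (simp add: mult.commute)
  qed
  have g\<sigma>: "(\<Sum>i\<in>Basis. (g x \<bullet> i) * \<phi> i x) = g x \<bullet> x * \<sigma> x" for x
    by (simp add: \<phi>_def euclidean_inner[of "g x" x] sum_distrib_right sum_distrib_left algebra_simps)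
  show "integrable M (\<lambda>x. g x \<bullet> x * \<sigma> x)"
    using Bochner_Integration.integrable_sum[of Basis M "\<lambda>i x. (g x \<bullet> i) * \<phi> i x"] g\<phi> by (simp add: g\<sigma>)
  show k1: "integrable M k"
    using int[OF k_smooth k0 loc_integrable_const, of "1::real"] by simp
  show s1: "integrable M \<sigma>"
    using int[OF \<sigma>_smooth \<sigma>0 loc_integrable_const, of "1::real"] by simp
  have ud: "integrable M (\<lambda>x. u x * d i x)" if "i \<in> Basis" for i
    using int[OF d_smooth[OF that] d0 locu] by (simp add: mult.commute)
  have "N * (\<integral>x. u x * \<sigma> x \<partial>M) - (\<integral>x. u x * k x \<partial>M) = (\<integral>x. u x * (N * \<sigma> x - k x) \<partial>M)"
    using uk us by (simp add: right_diff_distrib mult.left_commute[of _ N])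
  also have "\<dots> = (\<integral>x. (\<Sum>i\<in>Basis. u x * d i x) \<partial>M)"
    by (simp add: sum_d flip: sum_distrib_left)
  also have "\<dots> = (\<Sum>i\<in>Basis. \<integral>x. u x * d i x \<partial>M)"
    using ud by (rule Bochner_Integration.integral_sum)
  also have "\<dots> = (\<Sum>i\<in>Basis. - (\<integral>x. (g x \<bullet> i) * \<phi> i x \<partial>M))"
  proof (rule sum.cong[OF refl])
    fix i :: 'a assume i: "i \<in> Basis"
    have "(\<integral>x. u x * frechet_derivative (\<phi> i) (at x) i \<partial>M) = - (\<integral>x. (g x \<bullet> i) * \<phi> i x \<partial>M)"
      using grad test[of i] i unfolding has_weak_gradient_def by blast
    then show "(\<integral>x. u x * d i x \<partial>M) = - (\<integral>x. (g x \<bullet> i) * \<phi> i x \<partial>M)"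
      by (simp add: fd[OF i])
  qed
  also have "\<dots> = - (\<integral>x. g x \<bullet> x * \<sigma> x \<partial>M)"
    using Bochner_Integration.integral_sum[of Basis M "\<lambda>i x. (g x \<bullet> i) * \<phi> i x"] g\<phi>
    by (simp add: g\<sigma> sum_negf)
  finally show "(\<integral>x. u x * k x \<partial>M) = N * (\<integral>x. u x * \<sigma> x \<partial>M) + (\<integral>x. g x \<bullet> x * \<sigma> x \<partial>M)"
    by simp
  have d1: "integrable M (d i)" if "i \<in> Basis" for i
    using int[OF d_smooth[OF that] d0 loc_integrable_const, of "1::real"] by simp
  have "N * (\<integral>x. \<sigma> x \<partial>M) - (\<integral>x. k x \<partial>M) = (\<integral>x. N * \<sigma> x - k x \<partial>M)"
    using k1 s1 by simp
  also have "\<dots> = (\<integral>x. (\<Sum>i\<in>Basis. d i x) \<partial>M)"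
    by (simp add: sum_d)
  also have "\<dots> = (\<Sum>i\<in>Basis. \<integral>x. d i x \<partial>M)"
    using d1 by (rule Bochner_Integration.integral_sum)
  also have "\<dots> = 0"
    using integral_partial_derivative_eq_0_on[OF test _ B_sets] by (intro sum.neutral) (simp flip: fd)
  finally show "(\<integral>x. k x \<partial>M) = N * (\<integral>x. \<sigma> x \<partial>M)"
    by simp
qed

text \<open>Where the norm is at least \<open>s\<close>, monotonicity gives
  \<open>U s \<le> u x\<close>; where it is smaller, the weight \<open>k\<close> is of order 1/n and
  nonnegativity of \<open>u\<close> suffices. Hence the integral of \<open>u\<close> against
  \<open>k\<close> is at least \<open>U s\<close> times that of \<open>k\<close>, up to a vanishing
  error. Both integrals are rewritten by the divergence identities before the cutoff tends to the
  indicator.\<close>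

lemma monotone_divergence_aux:
  assumes r: "0 < s" "s < r" "r < 1"
  shows "U s * N * (\<integral>x. indicator (ball 0 r) x \<partial>M)
    \<le> N * (\<integral>x. u x * indicator (ball 0 r) x \<partial>M) + (\<integral>x. g x \<bullet> x * indicator (ball 0 r) x \<partial>M)"
proof -
  define \<sigma> where "\<sigma> n x = flat_exp 0 (real (Suc n) * (r\<^sup>2 - x \<bullet> x))" for n and x :: 'a
  define k where "k n x = 2 * real (Suc n) * (x \<bullet> x) * flat_exp 2 (real (Suc n) * (r\<^sup>2 - x \<bullet> x))" for n and x :: 'a
  define c where "c = r\<^sup>2 - s\<^sup>2"
  have c: "c > 0"
    using r by (simp add: c_def power_strict_mono)
  have r0: "0 < r" using r by simp
  note id = divergence_identity[OF r0 r(3), of "real (Suc n)" for n, folded \<sigma>_def k_def]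
  have k_nonneg: "0 \<le> k n x" for n x
    by (simp add: k_def flat_exp_nonneg)
  \<comment> \<open>The argument \<open>?y\<close> of \<open>flat_exp 2\<close> is at least
    \<open>real (Suc n) * c\<close>, and \<open>flat_exp 2 ?y\<close> is at most the inverse square
    of \<open>?y\<close>. This beats the single factor \<open>real (Suc n)\<close> in front.\<close>
  have k_inner: "k n x \<le> 2 / c\<^sup>2 * inverse (real (Suc n))" if x: "norm x < s" for n x
  proof -
    let ?y = "real (Suc n) * (r\<^sup>2 - x \<bullet> x)"
    have "x \<bullet> x \<le> s\<^sup>2"
      using x by (simp add: dot_square_norm power_mono)
    then have y: "real (Suc n) * c \<le> ?y"
      unfolding c_def by (intro mult_left_mono) auto
    have ypos: "0 < real (Suc n) * c"
      using c by simp
    have "flat_exp 2 ?y \<le> 1 / ?y\<^sup>2"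
      using order_less_le_trans[OF ypos y] by (rule flat_exp_le_inverse_power)
    also have "\<dots> \<le> 1 / (real (Suc n) * c)\<^sup>2"
      by (rule frac_le[OF zero_le_one order_refl zero_less_power[OF ypos] power_mono[OF y less_imp_le[OF ypos]]])
    finally have "k n x \<le> 2 * real (Suc n) * (x \<bullet> x) * (1 / (real (Suc n) * c)\<^sup>2)"
      unfolding k_def by (intro mult_left_mono) auto
    also have "x \<bullet> x \<le> 1"
      using x r by (simp add: dot_square_norm power_le_one)
    then have "2 * real (Suc n) * (x \<bullet> x) * (1 / (real (Suc n) * c)\<^sup>2) \<le> 2 * real (Suc n) * 1 * (1 / (real (Suc n) * c)\<^sup>2)"
      by (intro mult_left_mono mult_right_mono) auto
    also have "\<dots> = 2 / c\<^sup>2 * inverse (real (Suc n))"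
      using c by (simp add: power2_eq_square field_simps del: of_nat_Suc)
    finally show ?thesis .
  qed
  have lower: "U s * N * (\<integral>x. \<sigma> n x \<partial>M) - \<bar>U s\<bar> * (2 / c\<^sup>2 * inverse (real (Suc n))) * measure M (space M)
     \<le> N * (\<integral>x. u x * \<sigma> n x \<partial>M) + (\<integral>x. g x \<bullet> x * \<sigma> n x \<partial>M)" for n
  proof -
    have "U s * N * (\<integral>x. \<sigma> n x \<partial>M) - \<bar>U s\<bar> * (2 / c\<^sup>2 * inverse (real (Suc n))) * measure M (space M)
      = (\<integral>x. U s * k n x - \<bar>U s\<bar> * (2 / c\<^sup>2 * inverse (real (Suc n))) \<partial>M)"
      using id(4,7)[of n] by simp
    also have "\<dots> \<le> (\<integral>x. u x * k n x \<partial>M)"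
    proof (rule integral_mono_AE)
      show "AE x in M. U s * k n x - \<bar>U s\<bar> * (2 / c\<^sup>2 * inverse (real (Suc n))) \<le> u x * k n x"
        using u_nonneg u_eq AE_space[of M]
      proof eventually_elim
        case (elim x)
        show ?case
        proof (cases "norm x < s")
          case True
          have "U s * k n x \<le> \<bar>U s\<bar> * k n x"
            using k_nonneg by (intro mult_right_mono) auto
          also have "\<dots> \<le> \<bar>U s\<bar> * (2 / c\<^sup>2 * inverse (real (Suc n)))"
            using k_inner[OF True] by (intro mult_left_mono) auto
          finally show ?thesis
            using elim k_nonneg[of n x] mult_nonneg_nonneg[of "u x" "k n x"] by linarith
        next
          case False
          then have "U s \<le> u x"
            using elim U_mono[of s "norm x"] r by auto
          then have "U s * k n x \<le> u x * k n x"
            using k_nonneg by (intro mult_right_mono)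
          moreover have "0 \<le> \<bar>U s\<bar> * (2 / c\<^sup>2 * inverse (real (Suc n)))"
            by simp
          ultimately show ?thesis
            by linarith
        qed
      qed
    qed (use id(1,4)[of n] in auto)
    also have "\<dots> = N * (\<integral>x. u x * \<sigma> n x \<partial>M) + (\<integral>x. g x \<bullet> x * \<sigma> n x \<partial>M)"
      using id(6)[of n] by simp
    finally show ?thesis .
  qed
  have \<sigma>_lim: "(\<lambda>n. \<sigma> n x) \<longlonglongrightarrow> indicator (ball 0 r) x" for x
  proof -
    have "(r\<^sup>2 \<le> (norm x)\<^sup>2) = (r \<le> norm x)"
      by (rule power_mono_iff) (use r in auto)
    then have "(r\<^sup>2 - x \<bullet> x > 0) = (x \<in> ball 0 r)"
      by (auto simp: dot_square_norm)
    then have "(if r\<^sup>2 - x \<bullet> x > 0 then 1 else 0) = indicat_real (ball 0 r) x"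
      by (simp only: indicator_def of_bool_def)
    then show ?thesis
      using flat_exp_0_limit[of "r\<^sup>2 - x \<bullet> x"] by (simp only: \<sigma>_def)
  qed
  have \<sigma>_bound: "\<bar>\<sigma> n x\<bar> \<le> 1" for n x
    using flat_exp_nonneg flat_exp_0_le_1 by (simp add: \<sigma>_def)
  have lim: "(\<lambda>n. \<integral>x. f x * \<sigma> n x \<partial>M) \<longlonglongrightarrow> (\<integral>x. f x * indicator (ball 0 r) x \<partial>M)"
    if f: "integrable M f" and meas: "\<And>n. integrable M (\<lambda>x. f x * \<sigma> n x)" for f
  proof (rule integral_dominated_convergence[where w = "\<lambda>x. \<bar>f x\<bar>"])
    show "AE x in M. (\<lambda>n. f x * \<sigma> n x) \<longlonglongrightarrow> f x * indicator (ball 0 r) x"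
      by (intro AE_I2 tendsto_intros \<sigma>_lim)
    show "AE x in M. norm (f x * \<sigma> n x) \<le> \<bar>f x\<bar>" for n
      using \<sigma>_bound by (intro AE_I2) (simp add: abs_mult mult_left_le)
    show "(\<lambda>x. f x * \<sigma> n x) \<in> borel_measurable M" for n
      using meas[of n] by auto
    show "(\<lambda>x. f x * indicat_real (ball 0 r) x) \<in> borel_measurable M"
      using f by (intro borel_measurable_times ball_indicator_measurable) auto
  qed (use f in auto)
  have gx: "integrable M (\<lambda>x. g x \<bullet> x)"
  proof (rule Bochner_Integration.integrable_bound)
    show "integrable M (\<lambda>x. norm (g x))"
      using g_int by simp
    have "(\<lambda>x::'a. x) \<in> borel_measurable M"
      by (rule measurable_restrict_space1, rule measurable_completion) simp
    then show "(\<lambda>x. g x \<bullet> x) \<in> borel_measurable M"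
      by (intro borel_measurable_inner g_measurable)
    show "AE x in M. norm (g x \<bullet> x) \<le> norm (norm (g x))"
    proof (rule AE_I2)
      fix x assume "x \<in> space M"
      then have "norm x \<le> 1" by simp
      then have "norm (g x) * norm x \<le> norm (g x) * 1"
        by (intro mult_left_mono) auto
      then show "norm (g x \<bullet> x) \<le> norm (norm (g x))"
        using Cauchy_Schwarz_ineq2[of "g x" x] by simp
    qed
  qed
  \<comment> \<open>The factor 1 brings the integral into the shape of \<open>lim\<close> with the
    constant function 1.\<close>
  have lim1: "(\<lambda>n. U s * N * (\<integral>x. 1 * \<sigma> n x \<partial>M) - \<bar>U s\<bar> * (2 / c\<^sup>2 * inverse (real (Suc n))) * measure M (space M))
     \<longlonglongrightarrow> U s * N * (\<integral>x. 1 * indicator (ball 0 r) x \<partial>M) - \<bar>U s\<bar> * (2 / c\<^sup>2 * 0) * measure M (space M)"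
    using id(5) by (intro tendsto_intros lim LIMSEQ_inverse_real_of_nat) auto
  have lim2: "(\<lambda>n. N * (\<integral>x. u x * \<sigma> n x \<partial>M) + (\<integral>x. g x \<bullet> x * \<sigma> n x \<partial>M))
      \<longlonglongrightarrow> N * (\<integral>x. u x * indicator (ball 0 r) x \<partial>M) + (\<integral>x. g x \<bullet> x * indicator (ball 0 r) x \<partial>M)"
    using id(2,3) by (intro tendsto_intros lim u_int gx) auto
  show ?thesis
    using LIMSEQ_le[OF lim1 lim2] lower by simp
qed

text \<open>Only \<open>U s\<close> depends on \<open>s\<close> in the auxiliary inequality, so
  left-continuity of \<open>U\<close> at \<open>r\<close> allows \<open>s\<close> to tend to
  \<open>r\<close>.\<close>

lemma monotone_divergence:
  assumes r: "0 < r" "r < 1"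
  shows "U r * N * (\<integral>x. indicator (ball 0 r) x \<partial>M)
    \<le> N * (\<integral>x. u x * indicator (ball 0 r) x \<partial>M) + (\<integral>x. g x \<bullet> x * indicator (ball 0 r) x \<partial>M)"
proof (rule tendsto_upperbound)
  have "isCont U r"
    using continuous_on_subset[OF U_cont, of "{0<..<1}"] r
    by (auto simp: continuous_on_eq_continuous_at subset_iff)
  then have "(U \<longlongrightarrow> U r) (at_left r)"
    by (simp add: continuous_at_imp_continuous_at_within continuous_within[symmetric])
  then show "((\<lambda>s. U s * N * (\<integral>x. indicator (ball 0 r) x \<partial>M)) \<longlongrightarrow> U r * N * (\<integral>x. indicator (ball 0 r) x \<partial>M)) (at_left r)"
    by (intro tendsto_intros)
  have "\<forall>\<^sub>F s in at_left r. s \<in> {0<..<r}"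
    using r by (intro eventually_at_left_real)
  then show "\<forall>\<^sub>F s in at_left r. U s * N * (\<integral>x. indicator (ball 0 r) x \<partial>M)
    \<le> N * (\<integral>x. u x * indicator (ball 0 r) x \<partial>M) + (\<integral>x. g x \<bullet> x * indicator (ball 0 r) x \<partial>M)"
    by eventually_elim (use r monotone_divergence_aux in auto)
qed simp

section \<open>From the divergence inequality to pointwise decay\<close>

lemma N_pos: "N > 0"
  by (simp add: N_eq)

text \<open>Hoelder's inequality on a ball, with \<open>\<omega> + 1\<close> as a cruder constant.
  The number \<open>e\<close> is a strictly positive upper bound for the p-norm of the gradient
  rather than the norm itself, so that negative powers of \<open>e\<close> make sense.\<close>

lemma integral_norm_gradient_ball:
  assumes e: "0 < e" "Ep \<le> e powr p" and r: "0 < r" "r \<le> 1"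
  shows "(\<integral>x. norm (g x) * indicator (ball 0 r) x \<partial>M) \<le> (\<omega> + 1) * e * r powr (N - N / p)"
proof -
  \<comment> \<open>this \<open>t\<close> balances the two terms of the bound below\<close>
  define t where "t = e * r powr (- N / p)"
  have t: "t > 0"
    using e r by (simp add: t_def)
  have int: "integrable M (\<lambda>x. norm (g x) * indicator (ball 0 r) x)"
    by (intro integrable_mult_ball integrable_norm g_int)
  have "(\<integral>x. norm (g x) * indicator (ball 0 r) x \<partial>M)
      \<le> (\<integral>x. t * indicator (ball 0 r) x + norm (g x) powr p * t powr (1 - p) \<partial>M)"
  proof (rule integral_mono[OF int])
    show "integrable M (\<lambda>x. t * indicator (ball 0 r) x + norm (g x) powr p * t powr (1 - p))"
      using ball_indicator_int g_p_int by simp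
    show "norm (g x) * indicator (ball 0 r) x \<le> t * indicator (ball 0 r) x + norm (g x) powr p * t powr (1 - p)" for x
      using le_add_powr[of "norm (g x)" t p] t p by (simp add: indicator_def)
  qed
  also have "\<dots> = t * (\<omega> * r powr N) + Ep * t powr (1 - p)"
    using ball_indicator_int g_p_int r by (simp add: measure_ball)
  also have "\<dots> \<le> t * (\<omega> * r powr N) + e powr p * t powr (1 - p)"
    using e by (intro add_left_mono mult_right_mono) auto
  also have "t powr (1 - p) = e powr (1 - p) * r powr (N - N / p)"
    using e r p by (simp add: t_def powr_mult powr_powr right_diff_distrib)
  also have "e powr p * (e powr (1 - p) * r powr (N - N / p)) = e * r powr (N - N / p)"
    using e by (simp flip: powr_add mult.assoc)
  also have "t * (\<omega> * r powr N) = \<omega> * e * r powr (N - N / p)"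
    by (simp add: t_def powr_diff powr_minus divide_inverse)
  finally show ?thesis
    by (simp add: algebra_simps)
qed

text \<open>The function \<open>U r - u\<close> is nonnegative on the ball of radius
  \<open>r\<close> and at least \<open>U r - U (r / 2)\<close> on the ball of half the radius. Its
  integral is controlled by \<open>monotone_divergence\<close>, and the inner product of
  \<open>g x\<close> with \<open>x\<close> is at most \<open>r\<close> times the norm of
  \<open>g x\<close>.\<close>

lemma halving_aux:
  assumes e: "0 < e" "Ep \<le> e powr p" and r: "0 < r" "r < 1"
  shows "U r - U (r / 2) \<le> halving_const N \<omega> * e * r powr (1 - N / p)"
proof -
  have uint: "integrable M (\<lambda>x. u x * indicator (ball 0 r) x)"
    by (intro integrable_mult_ball u_int)
  have "N * (U r - U (r / 2)) * (\<omega> * (r / 2) powr N)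
      = N * (\<integral>x. (U r - U (r / 2)) * indicator (ball 0 (r / 2)) x \<partial>M)"
    using r by (simp add: measure_ball)
  also have "\<dots> \<le> N * (\<integral>x. U r * indicator (ball 0 r) x - u x * indicator (ball 0 r) x \<partial>M)"
  proof (intro mult_left_mono integral_mono_AE)
    show "AE x in M. (U r - U (r / 2)) * indicator (ball 0 (r / 2)) x
        \<le> U r * indicator (ball 0 r) x - u x * indicator (ball 0 r) x"
      using AE_norm_pos u_eq
    proof eventually_elim
      case (elim x)
      then show ?case
        using U_mono[of "norm x" r] U_mono[of "norm x" "r / 2"] r by (auto simp: indicator_def)
    qed
  qed (use ball_indicator_int uint N_pos in auto)
  also have "\<dots> = N * (U r * (\<integral>x. indicator (ball 0 r) x \<partial>M) - (\<integral>x. u x * indicator (ball 0 r) x \<partial>M))"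
    using ball_indicator_int uint by simp
  also have "\<dots> \<le> (\<integral>x. g x \<bullet> x * indicator (ball 0 r) x \<partial>M)"
    using monotone_divergence[OF r] by (simp add: algebra_simps)
  also have "\<dots> \<le> (\<integral>x. r * (norm (g x) * indicator (ball 0 r) x) \<partial>M)"
  proof (rule integral_mono')
    show "integrable M (\<lambda>x. r * (norm (g x) * indicator (ball 0 r) x))"
      by (intro integrable_mult_right integrable_mult_ball integrable_norm g_int)
    fix x
    show "g x \<bullet> x * indicator (ball 0 r) x \<le> r * (norm (g x) * indicator (ball 0 r) x)"
    proof (cases "x \<in> ball 0 r")
      case True
      have "g x \<bullet> x \<le> norm (g x) * norm x"
        by (rule norm_cauchy_schwarz)
      also have "\<dots> \<le> norm (g x) * r"
        using True by (intro mult_left_mono) auto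
      finally show ?thesis
        using True by (simp add: mult.commute)
    qed simp
  qed (use r in auto)
  also have "\<dots> \<le> r * ((\<omega> + 1) * e * r powr (N - N / p))"
    using integral_norm_gradient_ball[OF e, of r] r by simp
  also have "\<dots> = (\<omega> + 1) * e * r powr (1 - N / p) * r powr N"
    using r by (simp add: powr_diff)
  finally have "(U r - U (r / 2)) * (N * \<omega> / 2 powr N) * r powr N \<le> (\<omega> + 1) * e * r powr (1 - N / p) * r powr N"
    using r by (simp add: powr_divide mult_ac)
  then have "(U r - U (r / 2)) * (N * \<omega> / 2 powr N) \<le> (\<omega> + 1) * e * r powr (1 - N / p)"
    by (rule mult_right_le_imp_le) (use r in simp)
  then show ?thesis
    using N_pos \<omega>_pos by (simp add: halving_const_def field_simps)
qed

text \<open>The new case is \<open>r = 1\<close>, where no compactly supported cutoff reaches the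
  sphere; it follows by continuity of the profile from the left.\<close>

lemma halving:
  assumes e: "0 < e" "Ep \<le> e powr p" and r: "0 < r" "r \<le> 1"
  shows "U r - U (r / 2) \<le> halving_const N \<omega> * e * r powr (1 - N / p)"
proof (cases "r = 1")
  case False
  with halving_aux[OF e r(1)] r show ?thesis by simp
next
  case True
  have 1: "(U \<longlongrightarrow> U 1) (at_left 1)"
  proof -
    have "at 1 within {0<..1::real} = at_left 1"
      by (rule at_within_nhd[of _ "{0<..}"]) auto
    then show ?thesis
      using U_cont by (auto simp: continuous_on_def dest: bspec[of _ _ 1])
  qed
  have "isCont U (1 / 2)"
    using continuous_on_subset[OF U_cont, of "{0<..<1}"] by (auto simp: continuous_on_eq_continuous_at subset_iff)
  then have "(U \<longlongrightarrow> U (1 / 2)) (nhds (1 / 2))"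
    by (simp add: isCont_def tendsto_at_iff_tendsto_nhds)
  moreover have "filterlim (\<lambda>r. r / 2) (nhds (1 / 2 :: real)) (at_left 1)"
    by (intro tendsto_intros) auto
  ultimately have 2: "((\<lambda>r. U (r / 2)) \<longlongrightarrow> U (1 / 2)) (at_left 1)"
    by (rule filterlim_compose)
  have "U 1 - U (1 / 2) \<le> halving_const N \<omega> * e * 1 powr (1 - N / p)"
  proof (rule tendsto_le)
    show "((\<lambda>r. U r - U (r / 2)) \<longlongrightarrow> U 1 - U (1 / 2)) (at_left 1)"
      by (intro tendsto_intros 1 2)
    show "((\<lambda>r. halving_const N \<omega> * e * r powr (1 - N / p)) \<longlongrightarrow> halving_const N \<omega> * e * 1 powr (1 - N / p)) (at_left 1)"
      by (intro tendsto_intros) auto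
    have "\<forall>\<^sub>F s in at_left 1. s \<in> {0<..<1::real}"
      by (intro eventually_at_left_real) auto
    then show "\<forall>\<^sub>F r in at_left 1. U r - U (r / 2) \<le> halving_const N \<omega> * e * r powr (1 - N / p)"
      by eventually_elim (use halving_aux[OF e] in auto)
  qed simp
  with True show ?thesis by simp
qed

text \<open>The dyadic increments from \<open>halving\<close> are summed by induction on the scale.
  Since radii are at most 1, the assumption on \<open>\<beta>\<close> lets \<open>- \<beta>\<close>
  replace the exponent \<open>1 - N / p\<close>; its positivity makes the geometric series converge
  even when \<open>N < p\<close>.\<close>

lemma decay:
  assumes e: "0 < e" "Ep \<le> e powr p" and \<beta>: "0 < \<beta>" "N / p - 1 \<le> \<beta>" and r: "0 < r" "r \<le> 1"
  shows "U 1 - U r \<le> decay_const N \<omega> \<beta> * e * r powr - \<beta>"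
proof -
  define D where "D = halving_const N \<omega>"
  define A where "A = decay_const N \<omega> \<beta>"
  have D: "D > 0"
    using N_pos \<omega>_pos by (simp add: D_def halving_const_def)
  have b: "2 powr \<beta> > 1"
    using powr_less_mono[of 0 \<beta> 2] \<beta> by simp
  have "A * (2 powr \<beta> - 1) = D * (2 powr \<beta> - 1) + D"
    using b \<beta>(1) distrib_right[of D "D / (2 powr \<beta> - 1)" "2 powr \<beta> - 1"]
    by (simp add: A_def decay_const_def D_def[symmetric] distrib_left)
  moreover have "0 < D * (2 powr \<beta> - 1)"
    using D b by simp
  \<comment> \<open>This inequality closes the induction: passing from \<open>2 * r\<close> to
    \<open>r\<close> costs one increment with constant \<open>D\<close>, while the weight gains the
    factor 2^\<open>\<beta>\<close>.\<close>
  ultimately have AD: "A + D \<le> A * 2 powr \<beta>"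
    by (simp add: algebra_simps)
  have DA: "D \<le> A"
    using D b mult_left_mono[of 1 "1 + 1 / (2 powr \<beta> - 1)" D] by (simp add: A_def decay_const_def D_def[symmetric])
  note AD = AD DA
  have half: "U r - U (r / 2) \<le> D * e * r powr - \<beta>" if "0 < r" "r \<le> 1" for r
  proof -
    have "r powr (1 - N / p) \<le> r powr - \<beta>"
      using that \<beta> by (intro powr_mono') auto
    then have "D * e * r powr (1 - N / p) \<le> D * e * r powr - \<beta>"
      using D e by (intro mult_left_mono) auto
    with halving[OF e that] show ?thesis
      by (simp add: D_def)
  qed
  have "U 1 - U r \<le> A * e * r powr - \<beta>" if "(1/2) ^ k \<le> r" "r \<le> 1" for k r
    using that
  proof (induction k arbitrary: r)
    case 0
    then have "r = 1" by simp
    then show ?case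
      using AD D e by simp
  next
    case (Suc k)
    have r: "0 < r"
      using Suc.prems(1) zero_less_power[of "1/2::real" "Suc k"] by linarith
    show ?case
    proof (cases "r \<le> 1 / 2")
      case True
      have "U 1 - U (2 * r) \<le> A * e * (2 * r) powr - \<beta>"
        using Suc.IH[of "2 * r"] Suc.prems True by simp
      moreover have "U (2 * r) - U r \<le> D * e * (2 * r) powr - \<beta>"
        using half[of "2 * r"] r True by simp
      ultimately have "U 1 - U r \<le> (A + D) * (e * (2 * r) powr - \<beta>)"
        by (simp add: algebra_simps)
      also have "\<dots> \<le> (A * 2 powr \<beta>) * (e * (2 * r) powr - \<beta>)"
        using AD e by (intro mult_right_mono) auto
      also have "\<dots> = A * e * r powr - \<beta>"
        using r by (simp add: powr_mult powr_minus field_simps)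
      finally show ?thesis .
    next
      case False
      have "U (1 / 2) \<le> U r"
        using False Suc.prems by (intro U_mono) auto
      then have "U 1 - U r \<le> D * e * 1"
        using half[of 1] by simp
      also have "\<dots> \<le> A * e * r powr - \<beta>"
      proof (intro mult_mono)
        show "1 \<le> r powr - \<beta>"
          using r Suc.prems \<beta> powr_mono'[of "- \<beta>" 0 r] by simp
      qed (use AD D e in auto)
      finally show ?thesis .
    qed
  qed
  moreover obtain k where "(1/2) ^ k < r"
    using real_arch_pow_inv[OF r(1), of "1/2"] by auto
  ultimately show ?thesis
    using r unfolding A_def by (meson less_imp_le)
qed

lemma AE_decay:
  assumes e: "0 < e" "Ep \<le> e powr p" and \<beta>: "0 < \<beta>" "N / p - 1 \<le> \<beta>"
  shows "AE x in M. 0 \<le> U 1 - u x \<and> U 1 - u x \<le> decay_const N \<omega> \<beta> * e * norm x powr - \<beta>"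
  using AE_norm_pos u_eq AE_space[of M]
proof eventually_elim
  case (elim x)
  then show ?case
    using U_mono[of "norm x" 1] decay[OF e \<beta>, of "norm x"] by auto
qed

text \<open>The preceding bound needs a positive \<open>e\<close>, but the gradient integral may
  vanish. It is applied to a sequence decreasing to the norm, and countably many null sets are
  discarded before the limit.\<close>

lemma AE_decay_powr:
  assumes \<beta>: "0 < \<beta>" "N / p - 1 \<le> \<beta>"
  shows "AE x in M. 0 \<le> U 1 - u x \<and> U 1 - u x \<le> decay_const N \<omega> \<beta> * Ep powr (1 / p) * norm x powr - \<beta>"
proof -
  define e where "e n = Ep powr (1 / p) + inverse (real (Suc n))" for n
  have e: "0 < e n" for n
    by (simp add: e_def add_nonneg_pos)
  have "Ep \<ge> 0"
    by (rule Bochner_Integration.integral_nonneg) simp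
  then have "Ep = (Ep powr (1 / p)) powr p"
    using p by (simp add: powr_powr)
  also have "\<dots> \<le> e n powr p" for n
    using p by (intro powr_mono2) (auto simp: e_def)
  finally have "AE x in M. \<forall>n. 0 \<le> U 1 - u x \<and> U 1 - u x \<le> decay_const N \<omega> \<beta> * e n * norm x powr - \<beta>"
    unfolding AE_all_countable using AE_decay[OF e _ \<beta>] by blast
  then show ?thesis
  proof eventually_elim
    case (elim x)
    have "(\<lambda>n. decay_const N \<omega> \<beta> * e n * norm x powr - \<beta>)
        \<longlonglongrightarrow> decay_const N \<omega> \<beta> * (Ep powr (1 / p) + 0) * norm x powr - \<beta>"
      unfolding e_def by (intro tendsto_intros LIMSEQ_inverse_real_of_nat)
    from LIMSEQ_le_const[OF this, of "U 1 - u x"] elim show ?case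
      by auto
  qed
qed

end

section \<open>The energy estimate\<close>

text \<open>Bernoulli's inequality, read off from Young's inequality for the factors
  \<open>t powr a\<close> and 1 with weights \<open>1 / a\<close> and
  \<open>1 - 1 / a\<close>.\<close>

lemma powr_ge_tangent:
  fixes a t :: real
  assumes "1 \<le> a" "0 \<le> t"
  shows "1 + a * (t - 1) \<le> t powr a"
proof (cases "t = 0")
  case False
  have "(t powr a) powr (1 / a) * 1 powr (1 - 1 / a) \<le> 1 / a * t powr a + (1 - 1 / a) * 1"
    using assms False by (intro Youngs_inequality_0) auto
  then have "a * t \<le> a * (1 / a * t powr a + (1 - 1 / a))"
    using assms by (intro mult_left_mono) (auto simp: powr_powr)
  also have "\<dots> = t powr a + a - 1"
    using assms by (simp add: field_simps)
  finally show ?thesis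
    by (simp add: algebra_simps)
qed (use assms in simp)

text \<open>This is the tangent inequality at \<open>1 / t\<close>, multiplied by
  \<open>t powr a\<close>.\<close>

lemma powr_le_tangent:
  fixes a t :: real
  assumes "1 \<le> a" "0 \<le> t"
  shows "t powr a - 1 \<le> a * t powr (a - 1) * (t - 1)"
proof (cases "t = 0")
  case False
  have "(1 + a * (1 / t - 1)) * t powr a \<le> (1 / t) powr a * t powr a"
    using assms by (intro mult_right_mono powr_ge_tangent) auto
  also have "\<dots> = 1"
    using False assms by (simp flip: powr_mult)
  finally have "t powr a + a * (t powr a / t) - a * t powr a \<le> 1"
    by (simp add: algebra_simps)
  moreover have "a * t powr (a - 1) * (t - 1) = a * t powr a - a * (t powr a / t)"
    using False assms by (simp add: powr_diff right_diff_distrib)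
  ultimately show ?thesis
    by simp
qed simp

text \<open>The summand 1 in the constant covers \<open>b \<le> 1\<close>, where the power lies
  between \<open>t\<close> and 1; the other summand covers the convex case. Comparing only with the
  base point 1 keeps the bound valid down to \<open>t = 0\<close>, although the power need not be
  Lipschitz there.\<close>

lemma abs_powr_minus_1_le:
  fixes b t K :: real
  assumes b: "0 < b" and t: "0 \<le> t" "t \<le> K" and K: "1 \<le> K"
  shows "\<bar>t powr b - 1\<bar> \<le> (1 + b * K powr b) * \<bar>t - 1\<bar>"
proof (cases "b \<le> 1")
  case True
  have "\<bar>t powr b - 1\<bar> \<le> \<bar>t - 1\<bar>"
  proof (cases "t \<le> 1")
    case True
    then have "t \<le> t powr b"
      using \<open>b \<le> 1\<close> t powr_mono'[of b 1 t] by simp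
    moreover have "t powr b \<le> 1"
      using True t b powr_mono2[of b t 1] by simp
    ultimately show ?thesis
      by simp
  next
    case False
    then have "t powr b \<le> t" "1 \<le> t powr b"
      using \<open>b \<le> 1\<close> b powr_mono[of b 1 t] powr_mono[of 0 b t] by auto
    then show ?thesis
      by simp
  qed
  also have "\<dots> \<le> (1 + b * K powr b) * \<bar>t - 1\<bar>"
    using b by (simp add: distrib_right)
  finally show ?thesis .
next
  case False
  have "\<bar>t powr b - 1\<bar> \<le> b * K powr b * \<bar>t - 1\<bar>"
  proof (cases "t \<le> 1")
    case True
    have "1 - t powr b \<le> b * (1 - t)"
      using powr_ge_tangent[of b t] False t by (simp add: algebra_simps)
    also have "\<dots> \<le> b * K powr b * (1 - t)"
      using True b K by (intro mult_right_mono) (auto simp: ge_one_powr_ge_zero)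
    finally show ?thesis
      using True t b powr_mono2[of b t 1] by simp
  next
    case t1: False
    have "t powr b - 1 \<le> b * t powr (b - 1) * (t - 1)"
      using powr_le_tangent[of b t] False t by simp
    also have "t powr (b - 1) \<le> K powr (b - 1)"
      using False t by (intro powr_mono2) auto
    also have "K powr (b - 1) \<le> K powr b"
      using K by (intro powr_mono) auto
    finally have "t powr b - 1 \<le> b * K powr b * (t - 1)"
      using b t1 by (simp add: mult_left_mono mult_right_mono)
    moreover have "1 \<le> t powr b"
      using t1 b by (simp add: ge_one_powr_ge_zero)
    ultimately show ?thesis
      using t1 by simp
  qed
  then show ?thesis
    by (simp add: distrib_right)
qed

text \<open>For \<open>a < 2\<close> the second derivative is unbounded near 0, so a Taylor
  remainder is avoided. The lower bound is Bernoulli's inequality; the upper one compares the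
  derivative at \<open>t\<close> with the derivative at 1.\<close>

lemma powr_quadratic_bound:
  fixes a K :: real
  assumes a: "1 < a" and K: "1 \<le> K"
  obtains L where "0 < L" "\<And>t. 0 \<le> t \<Longrightarrow> t \<le> K \<Longrightarrow> \<bar>t powr a - 1 - a * (t - 1)\<bar> \<le> L * (t - 1)\<^sup>2"
proof
  let ?L = "1 + (a - 1) * K powr (a - 1)"
  have L: "0 < ?L"
    using a by (intro add_pos_nonneg) auto
  then show "0 < a * ?L"
    using a by simp
  show "\<bar>t powr a - 1 - a * (t - 1)\<bar> \<le> a * ?L * (t - 1)\<^sup>2" if t: "0 \<le> t" "t \<le> K" for t
  proof -
    have "t powr a - 1 - a * (t - 1) \<le> a * ((t powr (a - 1) - 1) * (t - 1))"
      using powr_le_tangent[of a t] a t by (simp add: algebra_simps)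
    also have "\<dots> \<le> a * (\<bar>t powr (a - 1) - 1\<bar> * \<bar>t - 1\<bar>)"
      using a by (intro mult_left_mono) (auto simp flip: abs_mult)
    also have "\<dots> \<le> a * ((?L * \<bar>t - 1\<bar>) * \<bar>t - 1\<bar>)"
      using a t K by (intro mult_left_mono mult_right_mono abs_powr_minus_1_le) auto
    also have "\<dots> = a * ?L * (t - 1)\<^sup>2"
      by (simp add: power2_eq_square mult.assoc flip: abs_mult)
    finally show ?thesis
      using powr_ge_tangent[of a t] a t by simp
  qed
qed

section \<open>The energy estimate on an abstract finite measure space\<close>

lemma powr_add_le:
  fixes a b p :: real
  assumes "0 \<le> a" "0 \<le> b" "0 \<le> p"
  shows "(a + b) powr p \<le> 2 powr p * (a powr p + b powr p)"
proof -
  have "(a + b) powr p \<le> (2 * max a b) powr p"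
    using assms by (intro powr_mono2) auto
  also have "\<dots> = 2 powr p * max a b powr p"
    using assms by (simp add: powr_mult)
  also have "max a b powr p \<le> a powr p + b powr p"
    by (simp add: max_def)
  finally show ?thesis
    by (simp add: mult_left_mono)
qed

text \<open>Here \<open>R\<close> stands for the decay profile, \<open>E\<close> for the gradient
  integral and \<open>1 + c\<close> for the boundary value of \<open>w\<close>. The point is the
  order of the quantifiers: \<open>\<delta>\<close> and \<open>C\<close> are fixed before
  \<open>w\<close>, \<open>E\<close> and \<open>c\<close>. Integrability of a power
  \<open>m > p\<close> of \<open>R\<close> makes the quadratic error of higher order than
  \<open>E\<close>.\<close>

lemma energy_estimate:
  fixes M :: "'a measure" and R :: "'a \<Rightarrow> real" and p q K A m :: real
  assumes fin: "finite_measure M" and \<omega>: "0 < measure M (space M)"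
    and R_nonneg: "\<And>x. 0 \<le> R x"
    and R_int: "integrable M R" "integrable M (\<lambda>x. R x powr p)" "integrable M (\<lambda>x. R x powr m)"
    and pq: "1 < p" "p < q" and m: "p < m" "m \<le> 2" and K: "1 \<le> K" and A: "0 \<le> A"
  obtains \<delta> C where "0 < \<delta>" "\<delta> < 1" "0 < C"
    "\<And>w E c. \<lbrakk>w \<in> borel_measurable M; AE x in M. 0 \<le> w x \<and> w x \<le> K; 0 \<le> E;
        AE x in M. 0 \<le> 1 + c - w x \<and> 1 + c - w x \<le> A * E powr (1 / p) * R x;
        E + (\<integral>x. \<bar>w x - 1\<bar> powr p \<partial>M) \<le> \<delta> powr p;
        E = (\<integral>x. w x powr q - w x powr p \<partial>M)\<rbrakk>
      \<Longrightarrow> C * (E + (\<integral>x. \<bar>w x - 1\<bar> powr p \<partial>M))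
        \<le> E / p + (\<integral>x. w x powr p / p - w x powr q / q \<partial>M) - (1 / p - 1 / q) * measure M (space M)"
proof -
  interpret finite_measure M by fact
  define \<omega> where "\<omega> = measure M (space M)"
  define J1 Jp Jm where "J1 = (\<integral>x. R x \<partial>M)" and "Jp = (\<integral>x. R x powr p \<partial>M)" and "Jm = (\<integral>x. R x powr m \<partial>M)"
  have J: "0 \<le> J1" "0 \<le> Jp" "0 \<le> Jm"
    unfolding J1_def Jp_def Jm_def by (auto intro!: Bochner_Integration.integral_nonneg R_nonneg)
  have \<omega>: "0 < \<omega>"
    using \<omega> by (simp add: \<omega>_def)
  obtain Lp where Lp: "0 < Lp" "\<And>t. 0 \<le> t \<Longrightarrow> t \<le> K \<Longrightarrow> \<bar>t powr p - 1 - p * (t - 1)\<bar> \<le> Lp * (t - 1)\<^sup>2"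
    using powr_quadratic_bound[OF pq(1) K] by metis
  have q1: "1 < q"
    using pq by simp
  obtain Lq where Lq: "0 < Lq" "\<And>t. 0 \<le> t \<Longrightarrow> t \<le> K \<Longrightarrow> \<bar>t powr q - 1 - q * (t - 1)\<bar> \<le> Lq * (t - 1)\<^sup>2"
    using powr_quadratic_bound[OF q1 K] by metis
  define L where "L = Lp + Lq"
  have L: "0 < L"
    using Lp Lq by (simp add: L_def)
  \<comment> \<open>\<open>G\<close> comes from the crude bound of \<open>c\<close> by
    \<open>\<delta>\<close>, which uses only closeness to 1; \<open>H\<close> comes from the sharper
    bound of \<open>c\<close> by E^(1/p), which uses the Nehari identity.\<close>
  define G where "G = (\<omega> + 1 + A * J1) / \<omega>"
  have "0 < \<omega> + 1 + A * J1"
    using \<omega> A J by (simp add: add_pos_nonneg)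
  then have G: "0 < G"
    using \<omega> by (simp add: G_def)
  define H where "H = 2 * ((q - p) * A * J1 + 1 + 4 * L * A * J1) / ((q - p) * \<omega>)"
  have H: "0 \<le> H"
    unfolding H_def using pq A J L \<omega> by (intro divide_nonneg_nonneg mult_nonneg_nonneg add_nonneg_nonneg) auto
  define C3 where "C3 = 1 + 2 powr p * (H powr p * \<omega> + A powr p * Jp)"
  have C3: "1 \<le> C3"
    using J \<omega> by (simp add: C3_def)
  define C4 where "C4 = 1 + 2 * H\<^sup>2 * \<omega> + 2 * 2 powr (2 - m) * A powr m * Jm"
  have C4: "0 < C4"
    unfolding C4_def using J \<omega> by (intro add_pos_nonneg mult_nonneg_nonneg) auto
  \<comment> \<open>In turn, the entries make E^(1/p) at most 1, make the absolute value of
    \<open>c\<close> at most 1, allow a term in c^2 to be absorbed, and leave half of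
    \<open>E / p\<close> after subtracting the quadratic error.\<close>
  define \<delta> where "\<delta> = Min {1 / 2, 1 / G, (q - p) / (4 * L * G), (1 / (2 * p * L * C4)) powr (1 / (m - p))}"
  have \<delta>0: "0 < \<delta>"
    unfolding \<delta>_def using G L pq C4 by (subst Min_gr_iff) auto
  have \<delta>12: "\<delta> \<le> 1 / 2"
    unfolding \<delta>_def by (intro Min_le) auto
  have \<delta>G: "G * \<delta> \<le> 1"
  proof -
    have "\<delta> \<le> 1 / G"
      unfolding \<delta>_def by (intro Min_le) auto
    then show ?thesis
      using G by (simp add: field_simps)
  qed
  have \<delta>L: "2 * L * G * \<delta> \<le> (q - p) / 2"
  proof -
    have "\<delta> \<le> (q - p) / (4 * L * G)"
      unfolding \<delta>_def by (intro Min_le) auto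
    then show ?thesis
      using G L by (simp add: field_simps)
  qed
  have \<delta>m: "L * C4 * \<delta> powr (m - p) \<le> 1 / (2 * p)"
  proof -
    have "\<delta> \<le> (1 / (2 * p * L * C4)) powr (1 / (m - p))"
      unfolding \<delta>_def by (intro Min_le) auto
    then have "\<delta> powr (m - p) \<le> ((1 / (2 * p * L * C4)) powr (1 / (m - p))) powr (m - p)"
      using \<delta>0 m by (intro powr_mono2) auto
    also have "\<dots> = 1 / (2 * p * L * C4)"
      using m L C4 pq by (simp add: powr_powr)
    finally show ?thesis
      using L C4 pq by (simp add: field_simps)
  qed
  show thesis
  proof (rule that)
    show "0 < \<delta>" "\<delta> < 1" "0 < 1 / (2 * p * C3)"
      using \<delta>0 \<delta>12 C3 pq by auto
    fix w :: "'a \<Rightarrow> real" and E c :: real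
    assume w_meas[measurable]: "w \<in> borel_measurable M" and w: "AE x in M. 0 \<le> w x \<and> w x \<le> K"
      and E: "0 \<le> E" and wR: "AE x in M. 0 \<le> 1 + c - w x \<and> 1 + c - w x \<le> A * E powr (1 / p) * R x"
      and V: "E + (\<integral>x. \<bar>w x - 1\<bar> powr p \<partial>M) \<le> \<delta> powr p"
      and nehari: "E = (\<integral>x. w x powr q - w x powr p \<partial>M)"
    define e where "e = E powr (1 / p)"
    have e: "0 \<le> e" "e powr p = E"
      using E pq by (auto simp: e_def powr_powr)
    define v where "v x = w x - 1" for x
    define z where "z x = 1 + c - w x" for x
    have [measurable]: "v \<in> borel_measurable M" "z \<in> borel_measurable M"
      unfolding v_def[abs_def] z_def[abs_def] by measurable
    have v_eq: "v x = c - z x" for x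
      by (simp add: v_def z_def)
    have z: "AE x in M. 0 \<le> z x \<and> z x \<le> A * e * R x"
      using wR by (simp add: z_def e_def)
    have v_bound: "AE x in M. \<bar>v x\<bar> \<le> K"
      using w by eventually_elim (use K in \<open>auto simp: v_def\<close>)
    have z_bound: "AE x in M. \<bar>z x\<bar> \<le> \<bar>c\<bar> + K"
      using v_bound by eventually_elim (auto simp: v_eq)
    have int_pow: "integrable M (\<lambda>x. \<bar>f x\<bar> powr a)" if "f \<in> borel_measurable M" "AE x in M. \<bar>f x\<bar> \<le> B" "0 \<le> a" for f and a B :: real
      using that(2) by (intro integrable_const_bound[of _ "B powr a"])
        (use that in \<open>auto elim!: eventually_mono intro: powr_mono2\<close>)
    have vp_int: "integrable M (\<lambda>x. \<bar>v x\<bar> powr p)"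
      using int_pow[OF _ v_bound, of p] pq by simp
    have v_int: "integrable M v"
      using v_bound by (intro integrable_const_bound[of _ K]) auto
    have z_int: "integrable M z"
      using z_bound by (intro integrable_const_bound[of _ "\<bar>c\<bar> + K"]) auto
    have v2_int: "integrable M (\<lambda>x. (v x)\<^sup>2)"
      using v_bound by (intro integrable_const_bound[of _ "K\<^sup>2"])
        (auto elim!: eventually_mono simp: power_mono abs_le_square_iff[symmetric])
    have z2_int: "integrable M (\<lambda>x. (z x)\<^sup>2)"
      using z_bound by (intro integrable_const_bound[of _ "(\<bar>c\<bar> + K)\<^sup>2"])
        (auto elim!: eventually_mono simp: power_mono abs_le_square_iff[symmetric])
    have wa_int: "integrable M (\<lambda>x. w x powr a)" if "0 \<le> a" for a
    proof (rule integrable_const_bound)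
      show "AE x in M. norm (w x powr a) \<le> K powr a"
        using w by eventually_elim (use that in \<open>auto intro: powr_mono2\<close>)
    qed simp
    define Vp where "Vp = (\<integral>x. \<bar>v x\<bar> powr p \<partial>M)"
    have Vp: "0 \<le> Vp" "E + Vp \<le> \<delta> powr p"
      using V by (auto simp: Vp_def v_def)
    have e\<delta>: "e \<le> \<delta>"
    proof -
      have "e \<le> (\<delta> powr p) powr (1 / p)"
        unfolding e_def using E Vp pq by (intro powr_mono2) auto
      then show ?thesis
        using \<delta>0 pq by (simp add: powr_powr)
    qed
    have e1: "e \<le> 1"
      using e\<delta> \<delta>12 by simp
    have Ee: "E \<le> e"
      using powr_mono'[of 1 p e] e e1 pq by simp
    have z1: "(\<integral>x. z x \<partial>M) \<le> A * e * J1" "0 \<le> (\<integral>x. z x \<partial>M)"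
    proof -
      have "(\<integral>x. z x \<partial>M) \<le> (\<integral>x. A * e * R x \<partial>M)"
        using z z_int R_int by (intro integral_mono_AE) (auto elim!: eventually_mono)
      then show "(\<integral>x. z x \<partial>M) \<le> A * e * J1"
        by (simp add: J1_def)
      show "0 \<le> (\<integral>x. z x \<partial>M)"
        using z by (intro integral_nonneg_AE) (auto elim!: eventually_mono)
    qed
    have zp: "(\<integral>x. \<bar>z x\<bar> powr p \<partial>M) \<le> A powr p * E * Jp"
    proof -
      have "(\<integral>x. \<bar>z x\<bar> powr p \<partial>M) \<le> (\<integral>x. A powr p * E * R x powr p \<partial>M)"
      proof (rule integral_mono_AE)
        show "AE x in M. \<bar>z x\<bar> powr p \<le> A powr p * E * R x powr p"
          using z
        proof eventually_elim
          case (elim x)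
          then have "\<bar>z x\<bar> powr p \<le> (A * e * R x) powr p"
            using pq by (intro powr_mono2) auto
          also have "\<dots> = A powr p * E * R x powr p"
            using A e R_nonneg by (simp add: powr_mult)
          finally show ?case .
        qed
      qed (use R_int int_pow[OF _ z_bound, of p] pq in auto)
      then show ?thesis
        by (simp add: Jp_def)
    qed
    \<comment> \<open>The constant \<open>c\<close> is the sum of \<open>v\<close> and
      \<open>z\<close>, so it is bounded through their integrals. Using \<open>le_add_powr\<close>
      at \<open>\<delta>\<close> turns the bound on the p-th power of \<open>v\<close> into one on
      its first power.\<close>
    have c_small: "\<bar>c\<bar> \<le> G * \<delta>"
    proof -
      have "\<omega> * \<bar>c\<bar> = \<bar>\<integral>x. v x + z x \<partial>M\<bar>"
        by (simp add: v_eq \<omega>_def abs_mult)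
      also have "\<dots> \<le> \<bar>\<integral>x. v x \<partial>M\<bar> + \<bar>\<integral>x. z x \<partial>M\<bar>"
        using v_int z_int by simp
      also have "\<bar>\<integral>x. v x \<partial>M\<bar> \<le> (\<integral>x. \<bar>v x\<bar> \<partial>M)"
        using integral_abs_bound by blast
      also have "(\<integral>x. \<bar>v x\<bar> \<partial>M) \<le> (\<integral>x. \<delta> + \<bar>v x\<bar> powr p * \<delta> powr (1 - p) \<partial>M)"
        using v_int vp_int pq \<delta>0 by (intro integral_mono le_add_powr) auto
      also have "\<dots> = \<omega> * \<delta> + Vp * \<delta> powr (1 - p)"
        using vp_int by (simp add: \<omega>_def Vp_def)
      also have "Vp * \<delta> powr (1 - p) \<le> \<delta> powr p * \<delta> powr (1 - p)"
        using Vp E by (intro mult_right_mono) auto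
      also have "\<delta> powr p * \<delta> powr (1 - p) = \<delta>"
        using \<delta>0 by (simp flip: powr_add)
      also have "\<bar>\<integral>x. z x \<partial>M\<bar> \<le> A * \<delta> * J1"
        using z1 e\<delta> A J by (auto intro: order_trans[OF _ mult_right_mono[OF mult_left_mono]])
      finally show ?thesis
        using \<omega> by (simp add: G_def field_simps)
    qed
    have c1: "\<bar>c\<bar> \<le> 1"
      using c_small \<delta>G by simp
    have z_le_2: "AE x in M. z x \<le> 2"
      using w by eventually_elim (use c1 in \<open>auto simp: z_def\<close>)
    \<comment> \<open>A bound of first order in \<open>e\<close> suffices for estimating
      \<open>c\<close>; the stronger bound with exponent \<open>m\<close> comes next and serves the
      energy expansion.\<close>
    have z2: "(\<integral>x. (z x)\<^sup>2 \<partial>M) \<le> 2 * (A * e * J1)"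
    proof -
      have "(\<integral>x. (z x)\<^sup>2 \<partial>M) \<le> (\<integral>x. 2 * z x \<partial>M)"
        using z z_le_2 by (intro integral_mono_AE z2_int)
          (use z_int in \<open>auto elim!: eventually_elim2 simp: power2_eq_square mult_right_mono\<close>)
      then show ?thesis
        using z1 by simp
    qed
    \<comment> \<open>Boundedness of \<open>z\<close> by 2 absorbs the power \<open>2 - m\<close> of
      z^2, and the decay bound is raised only to the power \<open>m\<close>, which is all that the
      integrability of \<open>R\<close> permits.\<close>
    have z2m: "(\<integral>x. (z x)\<^sup>2 \<partial>M) \<le> 2 powr (2 - m) * A powr m * Jm * e powr m"
    proof -
      have "(\<integral>x. (z x)\<^sup>2 \<partial>M) \<le> (\<integral>x. 2 powr (2 - m) * (A powr m * e powr m) * R x powr m \<partial>M)"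
      proof (rule integral_mono_AE)
        show "AE x in M. (z x)\<^sup>2 \<le> 2 powr (2 - m) * (A powr m * e powr m) * R x powr m"
          using z z_le_2
        proof eventually_elim
          case (elim x)
          have "(z x)\<^sup>2 = z x powr (2 - m) * z x powr m"
            using elim by (cases "z x = 0") (simp_all add: flip: powr_add)
          also have "\<dots> \<le> 2 powr (2 - m) * (A * e * R x) powr m"
            using elim m pq by (intro mult_mono powr_mono2) auto
          also have "(A * e * R x) powr m = A powr m * e powr m * R x powr m"
            using A e R_nonneg by (simp add: powr_mult)
          finally show ?case
            by (simp add: mult.assoc)
        qed
      qed (use R_int z2_int in auto)
      then show ?thesis
        by (simp add: Jm_def mult_ac)
    qed
    have v2_le: "(\<integral>x. (v x)\<^sup>2 \<partial>M) \<le> 2 * c\<^sup>2 * \<omega> + 2 * (\<integral>x. (z x)\<^sup>2 \<partial>M)"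
    proof -
      have "(\<integral>x. (v x)\<^sup>2 \<partial>M) \<le> (\<integral>x. 2 * c\<^sup>2 + 2 * (z x)\<^sup>2 \<partial>M)"
      proof (rule integral_mono[OF v2_int])
        show "(v x)\<^sup>2 \<le> 2 * c\<^sup>2 + 2 * (z x)\<^sup>2" for x
          using sum_squares_ge_zero[of "c + z x" 0] by (simp add: v_eq power2_eq_square algebra_simps)
      qed (use z2_int in auto)
      then show ?thesis
        using z2_int by (simp add: \<omega>_def algebra_simps)
    qed
    \<comment> \<open>At 1 the functions t^q and t^p have equal values, and their derivatives differ
      by \<open>q - p\<close>. The Nehari identity thus controls the mean of \<open>v\<close> up to
      a quadratic error.\<close>
    have neh: "(q - p) * \<bar>\<integral>x. v x \<partial>M\<bar> \<le> E + L * (\<integral>x. (v x)\<^sup>2 \<partial>M)"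
    proof -
      have "(q - p) * (\<integral>x. v x \<partial>M) - E = (\<integral>x. (q - p) * v x - (w x powr q - w x powr p) \<partial>M)"
        using v_int wa_int[of p] wa_int[of q] pq by (simp add: nehari)
      moreover have "\<bar>\<dots>\<bar> \<le> (\<integral>x. L * (v x)\<^sup>2 \<partial>M)"
      proof (rule order_trans[OF integral_abs_bound], rule integral_mono_AE)
        show "AE x in M. \<bar>(q - p) * v x - (w x powr q - w x powr p)\<bar> \<le> L * (v x)\<^sup>2"
          using w
        proof eventually_elim
          case (elim x)
          show ?case
            using Lp(2)[of "w x"] Lq(2)[of "w x"] elim by (simp add: v_def L_def algebra_simps)
        qed
      qed (use v2_int v_int wa_int[of p] wa_int[of q] pq in auto)
      ultimately have "\<bar>(q - p) * (\<integral>x. v x \<partial>M) - E\<bar> \<le> L * (\<integral>x. (v x)\<^sup>2 \<partial>M)"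
        by simp
      moreover have "(q - p) * \<bar>\<integral>x. v x \<partial>M\<bar> = \<bar>(q - p) * (\<integral>x. v x \<partial>M)\<bar>"
        using pq by (simp add: abs_mult)
      ultimately show ?thesis
        using E by linarith
    qed
    \<comment> \<open>The mean of \<open>v\<close> from the Nehari identity and that of
      \<open>z\<close> from decay determine \<open>c\<close>, except for a term in c^2. The crude
      smallness of \<open>c\<close> absorbs that term into the left side, which produces the factor
      2 in \<open>H\<close>.\<close>
    have cH: "\<bar>c\<bar> \<le> H * e"
    proof -
      have "\<bar>c\<bar> * \<omega> = \<bar>(\<integral>x. v x \<partial>M) + (\<integral>x. z x \<partial>M)\<bar>"
        using v_int z_int by (simp add: v_eq \<omega>_def abs_mult mult.commute)
      also have "\<dots> \<le> \<bar>\<integral>x. v x \<partial>M\<bar> + A * e * J1"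
        using z1 by linarith
      finally have "(q - p) * (\<bar>c\<bar> * \<omega>) \<le> (q - p) * (\<bar>\<integral>x. v x \<partial>M\<bar> + A * e * J1)"
        using pq by (intro mult_left_mono) auto
      also have "\<dots> \<le> e + L * (2 * c\<^sup>2 * \<omega> + 2 * (2 * (A * e * J1))) + (q - p) * (A * e * J1)"
      proof -
        have "L * (\<integral>x. (v x)\<^sup>2 \<partial>M) \<le> L * (2 * c\<^sup>2 * \<omega> + 2 * (2 * (A * e * J1)))"
          using v2_le z2 L by (intro mult_left_mono) auto
        then show ?thesis
          using neh Ee by (simp add: distrib_left)
      qed
      also have "L * (2 * c\<^sup>2 * \<omega> + 2 * (2 * (A * e * J1))) = (2 * L * \<bar>c\<bar>) * (\<bar>c\<bar> * \<omega>) + 4 * L * (A * e * J1)"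
        by (simp add: power2_eq_square algebra_simps)
      also have "(2 * L * \<bar>c\<bar>) * (\<bar>c\<bar> * \<omega>) \<le> ((q - p) / 2) * (\<bar>c\<bar> * \<omega>)"
      proof (intro mult_right_mono)
        have "2 * L * \<bar>c\<bar> \<le> 2 * L * (G * \<delta>)"
          using c_small L by (intro mult_left_mono) auto
        then show "2 * L * \<bar>c\<bar> \<le> (q - p) / 2"
          using \<delta>L by simp
      qed (use \<omega> in auto)
      finally have "(q - p) * (\<bar>c\<bar> * \<omega>)
          \<le> e + ((q - p) / 2 * (\<bar>c\<bar> * \<omega>) + 4 * L * (A * e * J1)) + (q - p) * (A * e * J1)"
        by simp
      moreover have "y \<le> 2 * (e + a + b)" if "y \<le> e + (y / 2 + a) + b" for y a b :: real
        using that by simp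
      ultimately have "(q - p) * (\<bar>c\<bar> * \<omega>) \<le> 2 * (e + 4 * L * (A * e * J1) + (q - p) * (A * e * J1))"
        by simp
      then have "\<bar>c\<bar> * ((q - p) * \<omega>) \<le> (2 * ((q - p) * A * J1 + 1 + 4 * L * A * J1)) * e"
        by (simp add: mult_ac distrib_left)
      then show ?thesis
        using pq \<omega> by (simp add: H_def pos_le_divide_eq)
    qed
    have V_le: "E + Vp \<le> C3 * E"
    proof -
      have "Vp \<le> (\<integral>x. 2 powr p * (\<bar>c\<bar> powr p + \<bar>z x\<bar> powr p) \<partial>M)"
        unfolding Vp_def
      proof (rule integral_mono[OF vp_int])
        fix x
        have "\<bar>v x\<bar> powr p \<le> (\<bar>c\<bar> + \<bar>z x\<bar>) powr p"
          using pq by (intro powr_mono2) (auto simp: v_eq)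
        also have "\<dots> \<le> 2 powr p * (\<bar>c\<bar> powr p + \<bar>z x\<bar> powr p)"
          using pq by (intro powr_add_le) auto
        finally show "\<bar>v x\<bar> powr p \<le> 2 powr p * (\<bar>c\<bar> powr p + \<bar>z x\<bar> powr p)" .
      qed (use int_pow[OF _ z_bound, of p] pq in auto)
      also have "\<dots> = 2 powr p * (\<bar>c\<bar> powr p * \<omega> + (\<integral>x. \<bar>z x\<bar> powr p \<partial>M))"
        using int_pow[OF _ z_bound, of p] pq by (simp add: \<omega>_def mult.commute)
      also have "\<dots> \<le> 2 powr p * (H powr p * E * \<omega> + A powr p * E * Jp)"
      proof (intro mult_left_mono add_mono mult_right_mono zp)
        have "\<bar>c\<bar> powr p \<le> (H * e) powr p"
          using cH pq by (intro powr_mono2) auto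
        then show "\<bar>c\<bar> powr p \<le> H powr p * E"
          using H e by (simp add: powr_mult)
      qed (use \<omega> in auto)
      finally show ?thesis
        by (simp add: C3_def algebra_simps)
    qed
    \<comment> \<open>The contribution of \<open>c\<close> is of order e^2, which is at most e^m
      since \<open>e \<le> 1\<close> and \<open>m \<le> 2\<close>.\<close>
    have v2_small: "(\<integral>x. (v x)\<^sup>2 \<partial>M) \<le> C4 * e powr m"
    proof -
      have "c\<^sup>2 \<le> (H * e)\<^sup>2"
        using cH H e by (simp add: abs_le_square_iff[symmetric])
      also have "\<dots> = H\<^sup>2 * e powr 2"
        using e by (simp add: power_mult_distrib)
      also have "\<dots> \<le> H\<^sup>2 * e powr m"
        using powr_mono'[of m 2 e] e e1 m by (intro mult_left_mono) auto
      finally have "2 * c\<^sup>2 * \<omega> \<le> 2 * (H\<^sup>2 * e powr m) * \<omega>"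
        using \<omega> by (intro mult_right_mono mult_left_mono) auto
      then have "(\<integral>x. (v x)\<^sup>2 \<partial>M) \<le> 2 * (H\<^sup>2 * e powr m) * \<omega> + 2 * (2 powr (2 - m) * A powr m * Jm * e powr m)"
        using v2_le z2m by linarith
      also have "\<dots> \<le> C4 * e powr m"
        by (simp add: C4_def algebra_simps)
      finally show ?thesis .
    qed
    \<comment> \<open>Since e^p is \<open>E\<close>, the quadratic error is \<open>E\<close> times a
      constant and e^(m - p), a factor made small by \<open>e \<le> \<delta>\<close>.\<close>
    have "E / p - 1 / (2 * p) * E \<le> E / p - L * (\<integral>x. (v x)\<^sup>2 \<partial>M)"
    proof -
      have "L * (\<integral>x. (v x)\<^sup>2 \<partial>M) \<le> L * (C4 * e powr m)"
        using v2_small L by (intro mult_left_mono) auto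
      also have "e powr m = e powr (m - p) * E"
        unfolding e(2)[symmetric] by (simp flip: powr_add)
      also have "L * (C4 * (e powr (m - p) * E)) \<le> L * (C4 * (\<delta> powr (m - p) * E))"
        using e e\<delta> m E L C4 by (intro mult_left_mono mult_right_mono powr_mono2) auto
      also have "\<dots> = (L * C4 * \<delta> powr (m - p)) * E"
        by simp
      also have "\<dots> \<le> 1 / (2 * p) * E"
        using \<delta>m E by (intro mult_right_mono)
      finally show ?thesis
        by simp
    qed
    also have "\<dots> \<le> E / p + (\<integral>x. w x powr p / p - w x powr q / q \<partial>M) - (1 / p - 1 / q) * \<omega>"
    proof -
      \<comment> \<open>The linear terms of t^p / p and t^q / q at 1 coincide and cancel, leaving
        the constant and a quadratic remainder.\<close>
      have "(\<integral>x. (1 / p - 1 / q) - L * (v x)\<^sup>2 \<partial>M) \<le> (\<integral>x. w x powr p / p - w x powr q / q \<partial>M)"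
      proof (rule integral_mono_AE)
        show "AE x in M. (1 / p - 1 / q) - L * (v x)\<^sup>2 \<le> w x powr p / p - w x powr q / q"
          using w
        proof eventually_elim
          case (elim x)
          have "w x powr p / p \<ge> (1 + p * v x - Lp * (v x)\<^sup>2) / p"
            using Lp(2)[of "w x"] elim pq by (intro divide_right_mono) (auto simp: v_def)
          moreover have "w x powr q / q \<le> (1 + q * v x + Lq * (v x)\<^sup>2) / q"
            using Lq(2)[of "w x"] elim pq by (intro divide_right_mono) (auto simp: v_def)
          moreover have "(1 + p * v x - Lp * (v x)\<^sup>2) / p - (1 + q * v x + Lq * (v x)\<^sup>2) / q
              = (1 / p - 1 / q) - (Lp * (v x)\<^sup>2 / p + Lq * (v x)\<^sup>2 / q)"
            using pq by (simp add: field_simps)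
          moreover have "Lp * (v x)\<^sup>2 / p \<le> Lp * (v x)\<^sup>2 / 1" "Lq * (v x)\<^sup>2 / q \<le> Lq * (v x)\<^sup>2 / 1"
            using Lp Lq pq by (intro divide_left_mono; simp)+
          moreover have "L * (v x)\<^sup>2 = Lp * (v x)\<^sup>2 + Lq * (v x)\<^sup>2"
            by (simp add: L_def algebra_simps)
          ultimately show ?case
            by linarith
        qed
      qed (use v2_int wa_int[of p] wa_int[of q] pq in auto)
      then show ?thesis
        using v2_int by (simp add: \<omega>_def mult.commute)
    qed
    finally have "1 / (2 * p) * E \<le> E / p + (\<integral>x. w x powr p / p - w x powr q / q \<partial>M) - (1 / p - 1 / q) * \<omega>"
      using pq by (simp add: field_simps)
    moreover have "1 / (2 * p * C3) * (E + Vp) \<le> 1 / (2 * p * C3) * (C3 * E)"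
      using V_le pq C3 by (intro mult_left_mono) auto
    ultimately show "1 / (2 * p * C3) * (E + (\<integral>x. \<bar>w x - 1\<bar> powr p \<partial>M))
        \<le> E / p + (\<integral>x. w x powr p / p - w x powr q / q \<partial>M) - (1 / p - 1 / q) * measure M (space M)"
      using C3 by (simp add: Vp_def v_def \<omega>_def)
  qed
qed

text \<open>
  This convexity inequality yields Minkowski's inequality for \<open>w = (w - 1) + 1\<close> once it is integrated
  with \<open>y = |B|\<^sup>1\<^sup>/\<^sup>p\<close>.
\<close>

lemma powr_add_1_le:
  fixes p t y :: real
  assumes p: "1 \<le> p" and t: "0 \<le> t" and y: "0 < y"
  shows "(t + 1) powr p \<le> (1 + y) powr (p - 1) * (t powr p + y powr (1 - p))"
proof -
  \<comment> \<open>With weights \<open>1 / (1 + y)\<close> and \<open>y / (1 + y)\<close> the mean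
    of \<open>X\<close> and \<open>Y\<close> is 1. Convexity can then be used through the tangent at
    1 alone, and multiplying by \<open>(t + 1) powr p\<close> restores the scale.\<close>
  define X where "X = t * (1 + y) / (t + 1)"
  define Y where "Y = (1 + y) / (y * (t + 1))"
  have XY: "0 \<le> X" "0 \<le> Y"
    using t y by (auto simp: X_def Y_def)
  have avg: "1 / (1 + y) * X + y / (1 + y) * Y = 1"
  proof -
    have "1 / (1 + y) * X = t / (t + 1)"
      using t y by (simp add: X_def)
    moreover have "y / (1 + y) * Y = 1 / (t + 1)"
      using t y by (simp add: Y_def)
    ultimately show ?thesis
      using t by (simp add: add_divide_distrib[symmetric])
  qed
  have w1: "1 / (1 + y) + y / (1 + y) = 1"
    using y by (simp add: add_divide_distrib[symmetric])
  have "1 = (1 / (1 + y) + y / (1 + y)) * (1 - p) + p * (1 / (1 + y) * X + y / (1 + y) * Y)"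
    unfolding w1 avg by simp
  also have "\<dots> = 1 / (1 + y) * (1 + p * (X - 1)) + y / (1 + y) * (1 + p * (Y - 1))"
  proof -
    have "(a + b) * (1 - p) + p * (a * X + b * Y) = a * (1 + p * (X - 1)) + b * (1 + p * (Y - 1))" for a b
      by (simp add: algebra_simps)
    then show ?thesis .
  qed
  also have "\<dots> \<le> 1 / (1 + y) * X powr p + y / (1 + y) * Y powr p"
    using y p XY by (intro add_mono mult_left_mono powr_ge_tangent) auto
  finally have "1 * (t + 1) powr p \<le> (1 / (1 + y) * X powr p + y / (1 + y) * Y powr p) * (t + 1) powr p"
    by (intro mult_right_mono) auto
  also have "\<dots> = (X * (t + 1)) powr p / (1 + y) + y / (1 + y) * (Y * (t + 1)) powr p"
    using t XY by (simp add: powr_mult distrib_right)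
  also have "X * (t + 1) = t * (1 + y)"
    using t by (simp add: X_def)
  also have "Y * (t + 1) = (1 + y) / y"
    using t y by (simp add: Y_def)
  also have "(t * (1 + y)) powr p / (1 + y) + y / (1 + y) * ((1 + y) / y) powr p
      = (1 + y) powr (p - 1) * (t powr p + y powr (1 - p))"
  proof -
    have "(t * (1 + y)) powr p / (1 + y) = (1 + y) powr (p - 1) * t powr p"
      using t y by (simp add: powr_mult powr_diff)
    moreover have "y / (1 + y) * ((1 + y) / y) powr p = (1 + y) powr (p - 1) * y powr (1 - p)"
      using y by (simp add: powr_divide powr_diff)
    ultimately show ?thesis
      by (simp only: distrib_left)
  qed
  finally show ?thesis
    by simp
qed

section \<open>Measurability, the chosen weak gradient and the truncated primitive\<close>

lemma borel_measurable_lebesgue_on_AE_eq: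
  fixes f g :: "'a::euclidean_space \<Rightarrow> 'b::topological_space"
  assumes S: "S \<in> sets lebesgue" and g: "g \<in> borel_measurable (lebesgue_on S)"
    and eq: "AE x in lebesgue_on S. f x = g x"
  shows "f \<in> borel_measurable (lebesgue_on S)"
proof (rule measurableI)
  obtain Z where Z: "{x \<in> space (lebesgue_on S). f x \<noteq> g x} \<subseteq> Z" "Z \<in> null_sets (lebesgue_on S)"
    using eq by (auto simp: eventually_ae_filter)
  fix A :: "'b set" assume A: "A \<in> sets borel"
  \<comment> \<open>Completeness of Lebesgue measure makes the part of the preimage inside
    \<open>Z\<close> measurable; outside \<open>Z\<close> the preimages under \<open>f\<close> and
    \<open>g\<close> agree.\<close>
  have "Z \<in> null_sets lebesgue"
    using Z(2) S by (simp add: null_sets_restrict_space)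
  then have "f -` A \<inter> S \<inter> Z \<in> null_sets lebesgue"
    by (rule null_sets_completion_subset[rotated]) blast
  then have "f -` A \<inter> S \<inter> Z \<in> sets (lebesgue_on S)"
    using S by (auto simp: sets_restrict_space_iff)
  moreover have "g -` A \<inter> space (lebesgue_on S) - Z \<in> sets (lebesgue_on S)"
    using measurable_sets[OF g A] Z(2) by (intro sets.Diff) auto
  moreover have "f -` A \<inter> space (lebesgue_on S) = (g -` A \<inter> space (lebesgue_on S) - Z) \<union> (f -` A \<inter> S \<inter> Z)"
    using Z(1) by auto
  ultimately show "f -` A \<inter> space (lebesgue_on S) \<in> sets (lebesgue_on S)"
    by (simp only: sets.Un)
qed simp

text \<open>Membership in \<open>W1p\<close> provides some gradient in the Lebesgue space, not
  necessarily the one selected by \<open>SOME\<close>. Uniqueness almost everywhere transfers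
  measurability and integrability to the selected one.\<close>

lemma weak_gradient_Lp:
  fixes u :: "'a::euclidean_space \<Rightarrow> real"
  assumes "u \<in> W1p unit_ball p"
  shows "has_weak_gradient unit_ball u (weak_gradient unit_ball u)"
    and "weak_gradient unit_ball u \<in> Lp unit_ball p"
proof -
  obtain g where g: "g \<in> Lp unit_ball p" "has_weak_gradient unit_ball u g"
    using assms by (auto simp: W1p_def)
  show G: "has_weak_gradient unit_ball u (weak_gradient unit_ball u)"
    unfolding weak_gradient_def by (rule someI[of _ g]) (rule g)
  have eq: "AE x in lebesgue_on unit_ball. weak_gradient unit_ball u x = g x"
    using weak_gradient_unique[OF open_ball G g(2)] .
  have meas: "weak_gradient unit_ball u \<in> borel_measurable (lebesgue_on unit_ball)"
    using g(1) by (intro borel_measurable_lebesgue_on_AE_eq[OF _ _ eq]) (simp_all add: Lp_def)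
  from eq have "integrable (lebesgue_on unit_ball) (\<lambda>x. norm (weak_gradient unit_ball u x) powr p)
      \<longleftrightarrow> integrable (lebesgue_on unit_ball) (\<lambda>x. norm (g x) powr p)"
    using meas g(1) by (intro integrable_cong_AE) (auto simp: Lp_def elim!: eventually_mono)
  with meas g(1) show "weak_gradient unit_ball u \<in> Lp unit_ball p"
    by (simp add: Lp_def)
qed

lemma AE_weak_gradient_const:
  "AE x::'a::euclidean_space in lebesgue_on unit_ball. weak_gradient unit_ball (\<lambda>_. c) x = 0"
proof -
  have "has_weak_gradient unit_ball (\<lambda>_::'a. 0) (\<lambda>_. 0)"
    by (simp add: has_weak_gradient_def loc_integrable_const)
  then have g: "has_weak_gradient unit_ball (\<lambda>_::'a. c) (\<lambda>_. 0)"
    using has_weak_gradient_add_const[OF fmeasurableD[OF lmeasurable_ball], of 0 1 "\<lambda>_. 0" "\<lambda>_. 0" c] by simp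
  then have "has_weak_gradient unit_ball (\<lambda>_::'a. c) (weak_gradient unit_ball (\<lambda>_. c))"
    unfolding weak_gradient_def by (rule someI[of _ "\<lambda>_. 0"])
  from weak_gradient_unique[OF open_ball this g] show ?thesis .
qed

lemma F_trunc_eq:
  assumes "0 \<le> t" "t \<le> s" "1 < q"
  shows "F_trunc s l q t = t powr q / q"
proof -
  have "continuous_on {0..t} (\<lambda>x. x powr (q - 1))"
    using assms by (intro continuous_on_powr') (auto intro!: continuous_intros)
  then have "set_integrable lborel {0..t} (\<lambda>x. x powr (q - 1))"
    by (rule borel_integrable_atLeastAtMost')
  then have int: "set_integrable lborel {0..t} (f_trunc s l q)"
    using assms by (subst set_integrable_cong[OF refl, where f' = "\<lambda>x. x powr (q - 1)"]) (auto simp: f_trunc_def)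
  have "F_trunc s l q t = integral {0..t} (f_trunc s l q)"
    unfolding F_trunc_def using assms int by (intro interval_integral_eq_integral) auto
  also have "\<dots> = integral {0..t} (\<lambda>x. x powr (q - 1))"
    using assms by (intro integral_cong) (auto simp: f_trunc_def)
  also have "\<dots> = t powr (q - 1 + 1) / (q - 1 + 1)"
    using assms by (intro integral_unique has_integral_powr_from_0) auto
  finally show ?thesis
    by simp
qed

section \<open>Combination of the decay and energy estimates on the ball\<close>

theorem theorem1p2:
  fixes p l C q s :: real
  assumes p: "1 < p" "p < 2"
    and l: "p < l" "ereal l < sobolev_exponent DIM('a::euclidean_space) p"
    and C: "embedding_constant TYPE('a) p C"
    and s: "s = trunc_level TYPE('a) p C"
    and q: "q > 2"
  shows "\<exists>\<delta> M. 0 < \<delta> \<and> \<delta> < 1 \<and> M > 0 \<and>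
    (\<forall>w \<in> (nehari p s l q :: ('a \<Rightarrow> real) set).
       W1p_norm unit_ball p (\<lambda>x. w x - 1) \<le> \<delta> \<longrightarrow>
       energy p s l q w - energy p s l q (\<lambda>x::'a. 1)
         \<ge> M * W1p_norm unit_ball p (\<lambda>x. w x - 1) powr p)"
proof -
  let ?B = "unit_ball :: 'a set" and ?M = "lebesgue_on (unit_ball :: 'a set)"
  define N where "N = real DIM('a)"
  define \<omega> where "\<omega> = measure lebesgue ?B"
  have N: "1 \<le> N"
    using DIM_positive[where 'a='a] by (simp add: N_def)
  have \<omega>: "0 < \<omega>"
    using content_ball_pos[of 1 "0::'a"] by (simp add: \<omega>_def)
  have \<omega>_M: "measure ?M (space ?M) = \<omega>"
    by (simp add: \<omega>_def measure_restrict_space)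
  interpret finite_measure ?M
    by (intro finite_measure_lebesgue_on) simp
  have s2: "2 \<le> s" and s_embed: "C * (1 + \<omega> powr (1 / p)) \<le> s"
    unfolding s trunc_level_def \<omega>_def by (auto simp: le_max_iff_disj)
  \<comment> \<open>The decay estimate needs \<open>\<beta> > 0\<close> and \<open>\<beta> \<ge> N/p - 1\<close>, the integrability of some power above \<open>p\<close> needs \<open>\<beta> p < N\<close>.\<close>
  define \<beta> where "\<beta> = (N - 1 / 2) / p"
  have \<beta>: "0 < \<beta>" "N / p - 1 \<le> \<beta>" "\<beta> * p = N - 1 / 2"
    using N p by (auto simp: \<beta>_def field_simps)
  define A where "A = decay_const N \<omega> \<beta>"
  have A: "0 \<le> A"
  proof -
    have "1 < 2 powr \<beta>"
      using powr_less_mono[of 0 \<beta> 2] \<beta> by simp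
    then show ?thesis
      unfolding A_def decay_const_def halving_const_def using N \<omega>
      by (intro mult_nonneg_nonneg divide_nonneg_nonneg add_nonneg_nonneg) auto
  qed
  \<comment> \<open>The increment \<open>p / (4 * N)\<close> is small enough for
    \<open>\<beta> * m < N\<close>, because (N - 1/2)(1 + 1/(4N)) is below N. The cap at 2 is
    required by the energy estimate, and \<open>p < 2\<close> keeps \<open>m\<close> above
    \<open>p\<close>.\<close>
  define m where "m = min 2 (p + p / (4 * N))"
  have m: "p < m" "m \<le> 2"
    using p N by (auto simp: m_def)
  have \<beta>m: "\<beta> * m < N"
  proof -
    have "\<beta> * m \<le> \<beta> * (p + p / (4 * N))"
      using \<beta> by (intro mult_left_mono) (auto simp: m_def)
    also have "\<dots> = \<beta> * p * (1 + 1 / (4 * N))"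
      by (simp add: algebra_simps)
    also have "\<dots> < N"
      unfolding \<beta>(3) using N by (simp add: field_simps)
    finally show ?thesis .
  qed
  have R_int: "integrable ?M (\<lambda>x. (norm x powr - \<beta>) powr a)" if "0 \<le> a" "a \<le> m" for a
  proof -
    have "\<beta> * a \<le> \<beta> * m"
      using that \<beta> by (intro mult_left_mono) auto
    with \<beta>m have "\<beta> * a < N"
      by linarith
    then have "integrable ?M (\<lambda>x. norm x powr - (\<beta> * a))"
      using that \<beta> by (intro integrable_norm_powr) (auto simp: N_def)
    then show ?thesis
      by (simp add: powr_powr)
  qed
  have R_int1: "integrable ?M (\<lambda>x. norm x powr - \<beta>)"
    using R_int[of 1] m p by simp
  \<comment> \<open>The pointwise bound \<open>K\<close> is instantiated with the truncation level,
    which depends only on the fixed data.\<close>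
  obtain \<delta> D where \<delta>: "0 < \<delta>" "\<delta> < 1" and D: "0 < D"
    and est: "\<And>w E c. \<lbrakk>w \<in> borel_measurable ?M; AE x in ?M. 0 \<le> w x \<and> w x \<le> s; 0 \<le> E;
        AE x in ?M. 0 \<le> 1 + c - w x \<and> 1 + c - w x \<le> A * E powr (1 / p) * norm x powr - \<beta>;
        E + (\<integral>x. \<bar>w x - 1\<bar> powr p \<partial>?M) \<le> \<delta> powr p;
        E = (\<integral>x. w x powr q - w x powr p \<partial>?M)\<rbrakk>
      \<Longrightarrow> D * (E + (\<integral>x. \<bar>w x - 1\<bar> powr p \<partial>?M))
        \<le> E / p + (\<integral>x. w x powr p / p - w x powr q / q \<partial>?M) - (1 / p - 1 / q) * \<omega>"
  proof (rule energy_estimate[of ?M "\<lambda>x. norm x powr - \<beta>" p m q s A, unfolded \<omega>_M])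
    show "integrable ?M (\<lambda>x. (norm x powr - \<beta>) powr p)" "integrable ?M (\<lambda>x. (norm x powr - \<beta>) powr m)"
      using p m by (intro R_int; simp)+
  qed (use finite_measure_axioms \<omega> R_int1 p q m s2 A that in auto)
  have energy_1: "energy p s l q (\<lambda>x::'a. 1) = (1 / p - 1 / q) * \<omega>"
  proof -
    have "F_trunc s l q 1 = 1 / q"
      using F_trunc_eq[of 1 s q l] s2 q by simp
    then have "energy p s l q (\<lambda>x::'a. 1)
        = (\<integral>x. norm (weak_gradient ?B (\<lambda>x. 1) x) powr p / p + (1 / p - 1 / q) \<partial>?M)"
      by (simp add: energy_def add_diff_eq)
    also have "\<dots> = (\<integral>x. 1 / p - 1 / q \<partial>?M)"
    proof (rule integral_cong_AE)
      show "(\<lambda>x. norm (weak_gradient ?B (\<lambda>x. 1) x) powr p / p + (1 / p - 1 / q)) \<in> borel_measurable ?M"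
      proof -
        have "weak_gradient ?B (\<lambda>x. 1) \<in> borel_measurable ?M"
          by (rule borel_measurable_lebesgue_on_AE_eq[OF _ _ AE_weak_gradient_const]) auto
        then show ?thesis
          by measurable
      qed
      show "AE x::'a in ?M. norm (weak_gradient ?B (\<lambda>x. 1) x) powr p / p + (1 / p - 1 / q) = 1 / p - 1 / q"
        using AE_weak_gradient_const[of 1] by eventually_elim simp
    qed simp
    finally show ?thesis
      using \<omega>_M by simp
  qed
  show ?thesis
  proof (rule exI[of _ \<delta>], rule exI[of _ D], intro conjI ballI impI \<delta> D)
    fix w :: "'a \<Rightarrow> real"
    assume w: "w \<in> nehari p s l q" and wn: "W1p_norm ?B p (\<lambda>x. w x - 1) \<le> \<delta>"
    have cone: "w \<in> mono_cone p" and neh: "(\<integral>x. norm (weak_gradient ?B w x) powr p + \<bar>w x\<bar> powr p \<partial>?M)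
       = (\<integral>x. f_trunc s l q (w x) * w x \<partial>?M)"
      using w by (auto simp: nehari_def)
    have w1p: "w \<in> W1p ?B p" and w0: "AE x in ?M. 0 \<le> w x"
      using cone by (auto simp: mono_cone_def W1p_rad_def)
    obtain U where U: "continuous_on {0<..1} U" "AE x in ?M. w x = U (norm x)"
      "\<And>r1 r2. 0 < r1 \<Longrightarrow> r1 \<le> r2 \<Longrightarrow> r2 \<le> 1 \<Longrightarrow> U r1 \<le> U r2"
      using cone by (auto simp: mono_cone_def radial_profile_def)
    define g where "g = weak_gradient ?B w"
    have g: "has_weak_gradient ?B w g" "g \<in> Lp ?B p"
      unfolding g_def using weak_gradient_Lp[OF w1p] by auto
    have gp_int: "integrable ?M (\<lambda>x. norm (g x) powr p)"
      using g(2) by (simp add: Lp_def)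
    have w_meas[measurable]: "w \<in> borel_measurable ?M" and w_Lp: "integrable ?M (\<lambda>x. \<bar>w x\<bar> powr p)"
      using w1p by (auto simp: W1p_def Lp_def)
    define E where "E = (\<integral>x. norm (g x) powr p \<partial>?M)"
    have E: "0 \<le> E"
      unfolding E_def by (rule Bochner_Integration.integral_nonneg) simp
    define V where "V = (\<integral>x. \<bar>w x - 1\<bar> powr p \<partial>?M)"
    have V: "0 \<le> V"
      unfolding V_def by (rule Bochner_Integration.integral_nonneg) simp
    have v_int: "integrable ?M (\<lambda>x. \<bar>w x - 1\<bar> powr p)"
    proof (rule Bochner_Integration.integrable_bound)
      show "integrable ?M (\<lambda>x. 2 powr p * (\<bar>w x\<bar> powr p + 1))"
        using w_Lp by simp
      show "AE x in ?M. norm (\<bar>w x - 1\<bar> powr p) \<le> norm (2 powr p * (\<bar>w x\<bar> powr p + 1))"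
      proof (rule AE_I2)
        fix x
        have "\<bar>w x - 1\<bar> powr p \<le> (\<bar>w x\<bar> + 1) powr p"
          using p by (intro powr_mono2) auto
        also have "\<dots> \<le> 2 powr p * (\<bar>w x\<bar> powr p + 1 powr p)"
          using p by (intro powr_add_le) auto
        finally show "norm (\<bar>w x - 1\<bar> powr p) \<le> norm (2 powr p * (\<bar>w x\<bar> powr p + 1))"
          by simp
      qed
    qed simp
    have norm_eq: "W1p_norm ?B p (\<lambda>x. w x - 1) = (E + V) powr (1 / p)"
    proof -
      have "weak_gradient ?B (\<lambda>x. w x - 1) = g"
        using weak_gradient_add_const[OF fmeasurableD[OF lmeasurable_ball], of 0 1 w "- 1"] by (simp add: g_def)
      then show ?thesis
        using gp_int v_int by (simp add: W1p_norm_def E_def V_def)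
    qed
    have norm_powr: "W1p_norm ?B p (\<lambda>x. w x - 1) powr p = E + V"
      unfolding norm_eq using p E V by (simp add: powr_powr)
    have EV: "E + V \<le> \<delta> powr p"
    proof -
      have "W1p_norm ?B p (\<lambda>x. w x - 1) powr p \<le> \<delta> powr p"
        using wn p by (intro powr_mono2) (auto simp: norm_eq)
      then show ?thesis
        by (simp add: norm_powr)
    qed
    have EV1: "E + V \<le> 1"
      using EV \<delta> p powr_le1[of p \<delta>] by simp
    define y where "y = \<omega> powr (1 / p)"
    have y: "0 < y" "\<omega> * y powr (1 - p) = y"
    proof -
      show "0 < y"
        using \<omega> by (simp add: y_def)
      have "\<omega> = y powr p"
        using \<omega> p by (simp add: y_def powr_powr)
      then show "\<omega> * y powr (1 - p) = y"
        using \<open>0 < y\<close> by (simp flip: powr_add)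
    qed
    \<comment> \<open>Minkowski's inequality for \<open>w = (w - 1) + 1\<close>, with
      \<open>y\<close> as the norm of the constant 1. The resulting bound \<open>1 + y\<close> is
      the factor multiplied by \<open>C\<close> in the truncation level.\<close>
    have w_norm: "W1p_norm ?B p w \<le> 1 + y"
    proof -
      have "(\<integral>x. \<bar>w x\<bar> powr p \<partial>?M) \<le> (\<integral>x. (1 + y) powr (p - 1) * (\<bar>w x - 1\<bar> powr p + y powr (1 - p)) \<partial>?M)"
      proof (rule integral_mono[OF w_Lp])
        fix x
        have "\<bar>w x\<bar> powr p \<le> (\<bar>w x - 1\<bar> + 1) powr p"
          using p by (intro powr_mono2) auto
        also have "\<dots> \<le> (1 + y) powr (p - 1) * (\<bar>w x - 1\<bar> powr p + y powr (1 - p))"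
          using p y by (intro powr_add_1_le) auto
        finally show "\<bar>w x\<bar> powr p \<le> (1 + y) powr (p - 1) * (\<bar>w x - 1\<bar> powr p + y powr (1 - p))" .
      qed (use v_int in simp)
      also have "\<dots> = (1 + y) powr (p - 1) * (V + y)"
        using v_int y \<omega>_M by (simp add: V_def)
      finally have "E + (\<integral>x. \<bar>w x\<bar> powr p \<partial>?M) \<le> 1 * E + (1 + y) powr (p - 1) * (V + y)"
        by simp
      \<comment> \<open>Enlarging the coefficient of \<open>E\<close> brings the gradient integral
        and the integral of the function under one common factor, so that
        \<open>E + V \<le> 1\<close> can be used.\<close>
      also have "\<dots> \<le> (1 + y) powr (p - 1) * E + (1 + y) powr (p - 1) * (V + y)"
        using y p E by (intro add_right_mono mult_right_mono) (auto intro: ge_one_powr_ge_zero)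
      also have "\<dots> = (1 + y) powr (p - 1) * (E + V + y)"
        by (simp add: algebra_simps)
      also have "\<dots> \<le> (1 + y) powr (p - 1) * (1 + y)"
        using EV1 by (intro mult_left_mono) auto
      also have "\<dots> = (1 + y) powr p"
        using y by (simp add: powr_diff)
      finally have "(E + (\<integral>x. \<bar>w x\<bar> powr p \<partial>?M)) powr (1 / p) \<le> ((1 + y) powr p) powr (1 / p)"
        using p E by (intro powr_mono2 add_nonneg_nonneg Bochner_Integration.integral_nonneg) auto
      then show ?thesis
        using gp_int w_Lp p y by (simp add: W1p_norm_def E_def powr_powr flip: g_def)
    qed
    \<comment> \<open>The embedding keeps \<open>w\<close> in the range where \<open>f_trunc\<close>
      and \<open>F_trunc\<close> are pure powers.\<close>
    have ws: "AE x in ?M. 0 \<le> w x \<and> w x \<le> s"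
    proof -
      \<comment> \<open>The sign of \<open>C\<close> is not among the assumptions; for negative
        \<open>C\<close> the left side is at most 0.\<close>
      have "C * W1p_norm ?B p w \<le> s"
      proof (cases "0 \<le> C")
        case True
        then have "C * W1p_norm ?B p w \<le> C * (1 + y)"
          using w_norm by (intro mult_left_mono)
        then show ?thesis
          using s_embed by (simp add: y_def)
      next
        case False
        then have "C * W1p_norm ?B p w \<le> 0"
          by (intro mult_nonpos_nonneg) (auto simp: W1p_norm_def)
        then show ?thesis
          using s2 by simp
      qed
      then have le: "esssup ?M (\<lambda>x. ereal \<bar>w x\<bar>) \<le> ereal s"
        using C cone unfolding embedding_constant_def by (meson ereal_less_eq(3) order_trans)
      have "AE x in ?M. \<bar>w x\<bar> \<le> s"
        using esssup_AE[of "\<lambda>x. ereal \<bar>w x\<bar>" ?M]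
      proof eventually_elim
        case (elim x)
        with le have "ereal \<bar>w x\<bar> \<le> ereal s"
          by (meson order_trans)
        then show ?case
          by simp
      qed
      with w0 show ?thesis
        by eventually_elim simp
    qed
    have wa_int: "integrable ?M (\<lambda>x. w x powr a)" if "0 \<le> a" for a
    proof (rule integrable_const_bound)
      show "AE x in ?M. norm (w x powr a) \<le> s powr a"
        using ws by eventually_elim (use that in \<open>auto intro: powr_mono2\<close>)
    qed simp
    have w_int: "integrable ?M w"
    proof (rule integrable_const_bound)
      show "AE x in ?M. norm (w x) \<le> s"
        using ws by eventually_elim auto
    qed simp
    interpret radial_monotone w g U p N \<omega>
      by unfold_locales (use p g U w0 w_int in \<open>auto simp: N_def \<omega>_def\<close>)
    \<comment> \<open>The decay bound is written with \<open>c = U 1 - 1\<close>, the deviation of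
      the boundary value from 1, to match \<open>est\<close>.\<close>
    have decay: "AE x in ?M. 0 \<le> 1 + (U 1 - 1) - w x \<and> 1 + (U 1 - 1) - w x \<le> A * E powr (1 / p) * norm x powr - \<beta>"
      using AE_decay_powr[OF \<beta>(1,2)] by (simp add: A_def E_def)
    have "E + (\<integral>x. w x powr p \<partial>?M) = (\<integral>x. norm (g x) powr p + \<bar>w x\<bar> powr p \<partial>?M)"
    proof -
      have "(\<integral>x. w x powr p \<partial>?M) = (\<integral>x. \<bar>w x\<bar> powr p \<partial>?M)"
        using ws by (intro integral_cong_AE) (auto elim!: eventually_mono)
      then show ?thesis
        using gp_int w_Lp by (simp add: E_def)
    qed
    also have "\<dots> = (\<integral>x. f_trunc s l q (w x) * w x \<partial>?M)"
      using neh by (simp add: g_def)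
    also have "\<dots> = (\<integral>x. w x powr q \<partial>?M)"
    proof (rule integral_cong_AE)
      show "(\<lambda>x. f_trunc s l q (w x) * w x) \<in> borel_measurable ?M"
        unfolding f_trunc_def by measurable
      show "AE x in ?M. f_trunc s l q (w x) * w x = w x powr q"
        using ws
      proof eventually_elim
        case (elim x)
        then have "f_trunc s l q (w x) * w x = w x powr (q - 1) * w x powr 1"
          by (simp add: f_trunc_def)
        also have "\<dots> = w x powr (q - 1 + 1)"
          by (rule powr_add[symmetric])
        finally show ?case
          by simp
      qed
    qed simp
    finally have nehari: "E = (\<integral>x. w x powr q - w x powr p \<partial>?M)"
      using wa_int[of p] wa_int[of q] p q by simp
    have "energy p s l q w = (\<integral>x. norm (g x) powr p / p + (w x powr p / p - w x powr q / q) \<partial>?M)"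
      unfolding energy_def g_def[symmetric]
    proof (rule integral_cong_AE)
      have F_eq: "AE x in ?M. F_trunc s l q (w x) = w x powr q / q"
        using ws by eventually_elim (use F_trunc_eq[of _ s q l] q in simp)
      have F_meas: "(\<lambda>x. F_trunc s l q (w x)) \<in> borel_measurable ?M"
        by (rule borel_measurable_lebesgue_on_AE_eq[OF _ _ F_eq]) auto
      show "(\<lambda>x. norm (g x) powr p / p + \<bar>w x\<bar> powr p / p - F_trunc s l q (w x)) \<in> borel_measurable ?M"
        using g_measurable F_meas by measurable
      show "(\<lambda>x. norm (g x) powr p / p + (w x powr p / p - w x powr q / q)) \<in> borel_measurable ?M"
        using g_measurable by measurable
      show "AE x in ?M. norm (g x) powr p / p + \<bar>w x\<bar> powr p / p - F_trunc s l q (w x)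
          = norm (g x) powr p / p + (w x powr p / p - w x powr q / q)"
        using ws by eventually_elim (use F_trunc_eq[of _ s q l] q in simp)
    qed
    also have "\<dots> = E / p + (\<integral>x. w x powr p / p - w x powr q / q \<partial>?M)"
      using gp_int wa_int[of p] wa_int[of q] p q by (simp add: E_def)
    finally show "D * W1p_norm ?B p (\<lambda>x. w x - 1) powr p \<le> energy p s l q w - energy p s l q (\<lambda>x::'a. 1)"
      using est[OF w_meas ws E decay EV[unfolded V_def] nehari] by (simp add: norm_powr V_def energy_1)
  qed
qed

end
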